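(* Let $V_0$ be a valuation of a field $K$ such that there exists an algebraically closed field $\mathbf k\subset R_{V_0}$ with $R_{V_0}/m_{V_0}\cong\mathbf k$. Let $f(z)\in R_{V_0}[z]$ be an irreducible unitary polynomial, and let $W$ be a pseudo valuation of $K[z]$ extending $V_0$ such that $I(W)_\infty=(f(z))$. Then there is a sequence of approximants to $f$ over $V_0$ $$V_1,\dots,V_k,\dots,$$ where $V_i=[V_{i-1};V_i(\phi_i)=W(\phi_i)]$ for all $i$, such that the key polynomials $\phi_i$ satisfy $\phi_1=z$ and, for $i\ge2$, $$\phi_i=\phi_{i-1}^{n_{i-1}}-c_{i-1}\phi_1^{j_1(i-1)}\cdots\phi_{i-2}^{j_{i-2}(i-1)}$$ with $c_{i-1}\in R_{V_0}$, $n_{i-1}=[G_{V_{i-1}}:G_{V_{i-2}}]$ and $0\le j_l(m)<n_l$ for all $l$ and $m$. The sequence is either of finite length $k$ with $\phi_k=f$ and $V_k(f(z))=\infty$, or it is infinite.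
   Context: Conventions. "Unitary" means monic. For a valuation $V$, $R_V$, $m_V$, $G_V$ denote valuation ring, maximal ideal, value group. A pseudo valuation on a domain $B$ is a map $V:B\to G_V\cup\{\infty\}$, $G_V$ a totally ordered abelian group, such that $I(V)_\infty=\{g\in B: V(g)=\infty\}$ is a prime ideal and $V$ induces a valuation with value group $G_V$ on the quotient field of $B/I(V)_\infty$. Equivalence. For a (pseudo) valuation $V$ of $K[z]$: $g\sim h$ in $V$ if $V(g-h)>\min\{V(g),V(h)\}$ or $V(g)=V(h)=\infty$; $h\mid g$ in $V$ if $g\sim ah$ in $V$ for some $a\in K[z]$; $g$ is equivalence irreducible in $V$ if $g\mid ab$ in $V$ implies $g\mid a$ or $g\mid b$ in $V$. Inductive valuations. Put $\phi_1=z$ and $V_1=[V_0;V_1(\phi_1)=\mu_1]$, i.e. $V_1(\sum a_iz^i)=\min_i(V_0(a_i)+i\mu_1)$. For $k\ge2$, $\phi_k\in K[z]$ is a key polynomial over $V_{k-1}$ with key value $\mu_k$ if: (1) $\phi_k$ is equivalence irreducible in $V_{k-1}$; (2) if $\phi_k\mid g$ in $V_{k-1}$ then $\deg_z\phi_k\le\deg_z g$; (3) $\phi_k$ is monic of positive degree; (4) $\mu_k>V_{k-1}(\phi_k)$; (5) $\deg_z\phi_k\ge\deg_z\phi_{k-1}$; (6) $\phi_k\sim\phi_{k-1}$ in $V_{k-1}$ is false. Then $V_k=[V_{k-1};V_k(\phi_k)=\mu_k]$ is defined by $V_k(g)=\min_i(V_{k-1}(g_i)+i\mu_k)$ where $g=\sum_i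 g_i\phi_k^i$ with $\deg_z g_i<\deg_z\phi_k$. Key values lie in an ordered abelian group containing the previous value group; $\mu_k=\infty$ is allowed only for the last stage (then $V_k$ is a pseudo valuation). It is known that $\deg_z\phi_{i}$ divides $\deg_z\phi_{i+1}$ and that each $g\in K[z]$ has a unique expansion $g=\sum_j a_j\phi_1^{m_{1,j}}\cdots\phi_k^{m_{k,j}}$, $a_j\in K$, $0\le m_{i,j}<\deg_z\phi_{i+1}/\deg_z\phi_i$ for $i<k$; $g$ is homogeneous in $V_k$ if all terms have the same $V_k$-value. Approximants. Writing $f=\sum f_j\phi_k^j$ with $\deg_z f_j<\deg_z\phi_k$, $\mathrm{proj}(V_k)=\alpha-\beta$, where $\alpha$ and $\beta$ are the largest and smallest exponents $j$ with $V_k(f)=V_k(f_j\phi_k^j)$ (zero has value $\infty$). $V_k$ is a $k$-th approximant to $f$ over $V_0$ if it is obtained by stages $V_1=[V_0;V_1(\phi_1)=\mu_1]$ with $\phi_1=z$, and, for $2\le i\le k$, $V_i=[V_{i-1};V_i(\phi_i)=\mu_i]$ with $\phi_i$ a key polynomial over $V_{i-1}$ with key value $\mu_i$ which is homogeneous in $V_{i-1}$, and $\mathrm{proj}(V_k)>0$. A sequence of approximants $V_1,V_2,\dots$ is one with $V_i=[V_{i-1};V_i(\phi_i)=\mu_i]$ an $i$-th approximant for each $i$. *)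

theory Defs
  imports "HOL-Algebra.Algebraic_Closure_Type" "HOL-Library.Extended_Nat"
begin

hide_const (open) Polynomials.degree UnivPoly.coeff UnivPoly.monom Module.smult
  Divisibility.irreducible Polynomials.lead_coeff Coset.order

datatype 'g vext = Fin 'g | Infty

instantiation vext :: (linorder) linorder
begin

fun less_eq_vext :: "'a vext \<Rightarrow> 'a vext \<Rightarrow> bool" where
  "Fin x \<le> Fin y \<longleftrightarrow> x \<le> y"
| "v \<le> Infty \<longleftrightarrow> True"
| "Infty \<le> Fin y \<longleftrightarrow> False"

definition less_vext :: "'a vext \<Rightarrow> 'a vext \<Rightarrow> bool" where
  "v < w \<longleftrightarrow> v \<le> w \<and> \<not> w \<le> (v :: 'a vext)"

instance
proof
  fix u v w :: "'a vext"
  show "v < w \<longleftrightarrow> v \<le> w \<and> \<not> w \<le> v" by (simp add: less_vext_def)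
  show "v \<le> v" by (cases v) auto
  show "u \<le> v \<Longrightarrow> v \<le> w \<Longrightarrow> u \<le> w" by (cases u; cases v; cases w) auto
  show "v \<le> w \<Longrightarrow> w \<le> v \<Longrightarrow> v = w" by (cases v; cases w) auto
  show "v \<le> w \<or> w \<le> v" by (cases v; cases w) auto
qed

end

instantiation vext :: (linordered_ab_group_add) ordered_comm_monoid_add
begin

definition zero_vext :: "'a vext" where "0 = Fin 0"

fun plus_vext :: "'a vext \<Rightarrow> 'a vext \<Rightarrow> 'a vext" where
  "Fin x + Fin y = Fin (x + y)"
| "Fin x + Infty = Infty"
| "Infty + v = Infty"

instance
proof
  fix u v w :: "'a vext"
  show "u + v + w = u + (v + w)" by (cases u; cases v; cases w) (auto simp: add.assoc)
  show "u + v = v + u" by (cases u; cases v) (auto simp: add.commute)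
  show "0 + u = u" by (cases u) (auto simp: zero_vext_def)
  show "u \<le> v \<Longrightarrow> w + u \<le> w + v" by (cases u; cases v; cases w) auto
qed

end

text \<open>The multiple \<open>n\<mu>\<close>, with \<open>0 \<infinity> = 0\<close>.\<close>

definition nmult :: "nat \<Rightarrow> 'g::linordered_ab_group_add vext \<Rightarrow> 'g vext" where
  "nmult n \<mu> = (\<Sum>i<n. \<mu>)"

text \<open>All value groups are taken inside one ordered abelian group, the type \<^typ>\<open>'g\<close>; the
  actual value group of \<open>V\<close> is the subgroup \<open>value_group V\<close> below.\<close>

definition valuation :: "('a::field \<Rightarrow> 'g::linordered_ab_group_add vext) \<Rightarrow> bool" where
  "valuation V \<longleftrightarrow> (\<forall>a. V a = Infty \<longleftrightarrow> a = 0) \<and> (\<forall>a b. V (a * b) = V a + V b) \<and>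
     (\<forall>a b. min (V a) (V b) \<le> V (a + b))"

definition valuation_ring :: "('a::field \<Rightarrow> 'g::linordered_ab_group_add vext) \<Rightarrow> 'a set" where
  "valuation_ring V = {a. 0 \<le> V a}"

definition valuation_ideal :: "('a::field \<Rightarrow> 'g::linordered_ab_group_add vext) \<Rightarrow> 'a set" where
  "valuation_ideal V = {a. 0 < V a}"

definition infinity_ideal :: "('b \<Rightarrow> 'g vext) \<Rightarrow> 'b set" where
  "infinity_ideal V = {g. V g = Infty}"

text \<open>The quotient field of \<open>B/I\<close> is handled through formal fractions \<open>a/b\<close> with \<open>b \<notin> I\<close>:
  \<open>v a b\<close> is the value of the class of \<open>a/b\<close>, where \<open>a/b = c/d\<close> iff \<open>ad - cb \<in> I\<close>, and \<open>a/b = 0\<close>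
  iff \<open>a \<in> I\<close>.\<close>

definition pseudo_valuation :: "('b::idom \<Rightarrow> 'g::linordered_ab_group_add vext) \<Rightarrow> bool" where
  "pseudo_valuation V \<longleftrightarrow>
     (let I = infinity_ideal V in
       primeideal I ring_of_type_algebra \<and>
       (\<exists>v :: 'b \<Rightarrow> 'b \<Rightarrow> 'g vext.
          (\<forall>a b c d. b \<notin> I \<and> d \<notin> I \<longrightarrow>
             (a * d - c * b \<in> I \<longrightarrow> v a b = v c d) \<and>
             (v a b = Infty \<longleftrightarrow> a \<in> I) \<and>
             v (a * c) (b * d) = v a b + v c d \<and>
             min (v a b) (v c d) \<le> v (a * d + c * b) (b * d)) \<and>
          (\<forall>a. v a 1 = V a)))"

lemma pseudo_valuation_iff:
  "pseudo_valuation V \<longleftrightarrow>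
     V 0 = Infty \<and> V 1 = 0 \<and> (\<forall>a b. V (a * b) = V a + V b) \<and>
     (\<forall>a b. min (V a) (V b) \<le> V (a + b))"
  (is "?L \<longleftrightarrow> ?R")
proof
  assume L: ?L
  let ?I = "infinity_ideal V"
  have prime: "primeideal ?I ring_of_type_algebra"
    using L by (auto simp: pseudo_valuation_def Let_def)
  obtain v where v: "\<And>a b c d. b \<notin> ?I \<and> d \<notin> ?I \<Longrightarrow>
             (a * d - c * b \<in> ?I \<longrightarrow> v a b = v c d) \<and>
             (v a b = Infty \<longleftrightarrow> a \<in> ?I) \<and>
             v (a * c) (b * d) = v a b + v c d \<and>
             min (v a b) (v c d) \<le> v (a * d + c * b) (b * d)"
    and v1: "\<And>a. v a 1 = V a"
    using L unfolding pseudo_valuation_def Let_def by blast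
  interpret primeideal ?I "ring_of_type_algebra" by (fact prime)
  have one: "1 \<notin> ?I"
    using I_notcarr one_imp_carrier by (auto simp: ring_of_type_algebra_def)
  have zero: "0 \<in> ?I"
    using a_subgroup additive_subgroup.zero_closed[OF is_additive_subgroup]
    by (simp add: ring_of_type_algebra_def)
  have mult: "V (a * b) = V a + V b" for a b
    using v[of 1 1 a b] one v1 by simp
  have "V 1 = V 1 + V 1" using mult[of 1 1] by simp
  moreover have "V 1 \<noteq> Infty" using one by (simp add: infinity_ideal_def)
  ultimately have "V 1 = 0" by (cases "V 1") (auto simp: zero_vext_def)
  moreover have "min (V a) (V b) \<le> V (a + b)" for a b
    using v[of 1 1 a b] one v1 by simp
  ultimately show ?R using mult zero by (auto simp: infinity_ideal_def)
next
  assume R: ?R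
  let ?I = "infinity_ideal V"
  have V0: "V 0 = Infty" and V1: "V 1 = 0" and mult: "\<And>a b. V (a * b) = V a + V b"
    and add: "\<And>a b. min (V a) (V b) \<le> V (a + b)" using R by auto
  have inf: "u + w = Infty \<longleftrightarrow> u = Infty \<or> w = Infty" for u w :: "'b vext"
    by (cases u; cases w) auto
  have addI: "V (a + b) = Infty" if "V a = Infty" "V b = Infty" for a b
    using add[of a b] that by (cases "V (a + b)") auto
  have "V (- 1) + V (- 1) = 0" using mult[of "- 1" "- 1"] V1 by simp
  then have "V (- 1) = 0"
    by (cases "V (- 1)") (auto simp: zero_vext_def)
  then have neg: "V (- a) = V a" for a using mult[of "- 1" a] by simp
  have prime: "primeideal ?I (ring_of_type_algebra :: 'a ring)"
  proof (rule primeidealI)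
    show "ideal ?I (ring_of_type_algebra :: 'a ring)"
    proof (rule idealI)
      have ag: "abelian_group (ring_of_type_algebra :: 'a ring)"
        using ring_from_type_algebra ring.is_abelian_group by blast
      have inv: "\<ominus>\<^bsub>ring_of_type_algebra\<^esub> a = - a" for a :: 'a
      proof -
        interpret R: ring "ring_of_type_algebra :: 'a ring" by auto
        show ?thesis by (rule R.minus_equality) (auto simp: ring_of_type_algebra_def)
      qed
      show "ring (ring_of_type_algebra :: 'a ring)" by auto
      show "subgroup ?I (add_monoid (ring_of_type_algebra :: 'a ring))"
      proof
        fix a assume "a \<in> ?I"
        then show "inv\<^bsub>add_monoid (ring_of_type_algebra :: 'a ring)\<^esub> a \<in> ?I"
          using inv[of a] neg by (simp add: a_inv_def infinity_ideal_def)
      qed (auto simp: ring_of_type_algebra_def infinity_ideal_def V0 addI)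
    qed (auto simp: ring_of_type_algebra_def infinity_ideal_def mult inf)
    show "cring (ring_of_type_algebra :: 'a ring)" by auto
    have "1 \<notin> ?I" by (simp add: infinity_ideal_def V1 zero_vext_def)
    then show "carrier (ring_of_type_algebra :: 'a ring) \<noteq> ?I"
      by (auto simp: ring_of_type_algebra_def)
  qed (auto simp: ring_of_type_algebra_def infinity_ideal_def mult inf)
  define v where "v a b = (case V a of Infty \<Rightarrow> Infty
     | Fin x \<Rightarrow> (case V b of Fin y \<Rightarrow> Fin (x - y) | Infty \<Rightarrow> Infty))" for a b
  have eq: "V a = V b" if "V (a - b) = Infty" for a b
  proof (rule antisym)
    show "V a \<le> V b"
      using add[of a "- (a - b)"] that neg[of "a - b"] by (cases "V a"; cases "V b") auto
    show "V b \<le> V a"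
      using add[of b "a - b"] that by (cases "V a"; cases "V b") auto
  qed
  have "(a * d - c * b \<in> ?I \<longrightarrow> v a b = v c d) \<and> (v a b = Infty \<longleftrightarrow> a \<in> ?I) \<and>
        v (a * c) (b * d) = v a b + v c d \<and>
        min (v a b) (v c d) \<le> v (a * d + c * b) (b * d)"
    if bd: "b \<notin> ?I \<and> d \<notin> ?I" for a b c d
  proof -
    obtain y w where [simp]: "V b = Fin y" "V d = Fin w"
      using bd by (cases "V b"; cases "V d") (auto simp: infinity_ideal_def)
    have "v a b = v c d" if "a * d - c * b \<in> ?I"
      using eq[of "a * d" "c * b"] that
      by (cases "V a"; cases "V c") (auto simp: infinity_ideal_def v_def mult algebra_simps)
    moreover have "min (v a b) (v c d) \<le> v (a * d + c * b) (b * d)"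
      using add[of "a * d" "c * b"]
      by (cases "V a"; cases "V c"; cases "V (a * d + c * b)")
        (auto simp: v_def mult min_def algebra_simps split: if_splits)
    moreover have "v (a * c) (b * d) = v a b + v c d"
      by (cases "V a"; cases "V c") (auto simp: v_def mult algebra_simps)
    ultimately show ?thesis
      by (cases "V a") (auto simp: v_def infinity_ideal_def)
  qed
  moreover have "v a 1 = V a" for a
    by (cases "V a") (auto simp: v_def V1 zero_vext_def)
  ultimately show ?L
    using prime unfolding pseudo_valuation_def Let_def by blast
qed

text \<open>The values of the nonzero fractions \<open>a/b\<close>, so for a pseudo valuation this is the value
  group of the induced valuation on the quotient field of \<open>B/I\<close>.\<close>

definition value_group :: "('b \<Rightarrow> 'g::linordered_ab_group_add vext) \<Rightarrow> 'g set" where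
  "value_group V = {x - y | x y. \<exists>a b. V a = Fin x \<and> V b = Fin y}"

definition has_index :: "'g::ab_group_add set \<Rightarrow> 'g set \<Rightarrow> nat \<Rightarrow> bool" where
  "has_index G H n \<longleftrightarrow>
     finite ((\<lambda>g. (+) g ` H) ` G) \<and> card ((\<lambda>g. (+) g ` H) ` G) = n"

definition equiv_in :: "('b::idom \<Rightarrow> 'g::linordered_ab_group_add vext) \<Rightarrow> 'b \<Rightarrow> 'b \<Rightarrow> bool" where
  "equiv_in V g h \<longleftrightarrow> min (V g) (V h) < V (g - h) \<or> (V g = Infty \<and> V h = Infty)"

definition dvd_in :: "('b::idom \<Rightarrow> 'g::linordered_ab_group_add vext) \<Rightarrow> 'b \<Rightarrow> 'b \<Rightarrow> bool" where
  "dvd_in V h g \<longleftrightarrow> (\<exists>a. equiv_in V g (a * h))"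

definition equiv_irreducible :: "('b::idom \<Rightarrow> 'g::linordered_ab_group_add vext) \<Rightarrow> 'b \<Rightarrow> bool" where
  "equiv_irreducible V g \<longleftrightarrow>
     (\<forall>a b. dvd_in V g (a * b) \<longrightarrow> dvd_in V g a \<or> dvd_in V g b)"

definition adic_coeff :: "'a::field poly \<Rightarrow> 'a poly \<Rightarrow> nat \<Rightarrow> 'a poly" where
  "adic_coeff \<phi> g i = (g div \<phi> ^ i) mod \<phi>"

lemma degree_adic_coeff:
  assumes "0 < degree \<phi>"
  shows "degree (adic_coeff \<phi> g i) < degree \<phi>"
proof -
  have "\<phi> \<noteq> 0" using assms by auto
  then show ?thesis
    using assms degree_mod_less[of \<phi> "g div \<phi> ^ i"] unfolding adic_coeff_def by auto
qed

lemma adic_expansion: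
  fixes \<phi> g :: "'a::field poly"
  assumes "0 < degree \<phi>"
  shows "g = (\<Sum>i\<le>degree g. adic_coeff \<phi> g i * \<phi> ^ i)"
proof -
  have *: "g = (\<Sum>i<n. adic_coeff \<phi> g i * \<phi> ^ i) + (g div \<phi> ^ n) * \<phi> ^ n" for n
  proof (induction n)
    case (Suc n)
    have "g div \<phi> ^ n = (g div \<phi> ^ Suc n) * \<phi> + adic_coeff \<phi> g n"
      unfolding adic_coeff_def
      by (metis div_mult_mod_eq power_Suc2 poly_div_mult_right)
    then have "(g div \<phi> ^ n) * \<phi> ^ n
        = adic_coeff \<phi> g n * \<phi> ^ n + (g div \<phi> ^ Suc n) * \<phi> ^ Suc n"
      by (simp add: algebra_simps)
    with Suc show ?case by (simp add: algebra_simps)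
  qed simp
  have "\<phi> \<noteq> 0" using assms by auto
  then have "degree (\<phi> ^ Suc (degree g)) = Suc (degree g) * degree \<phi>"
    by (rule degree_power_eq)
  moreover have "Suc (degree g) * 1 \<le> Suc (degree g) * degree \<phi>"
    using assms by (intro mult_le_mono2) simp
  ultimately have "degree g < degree (\<phi> ^ Suc (degree g))" by simp
  then have "g div \<phi> ^ Suc (degree g) = 0" by (rule div_poly_less)
  with *[of "Suc (degree g)"] show ?thesis by (simp add: lessThan_Suc_atMost)
qed

lemma adic_expansion_unique:
  fixes \<phi> :: "'a::field poly"
  assumes "\<And>i. degree (c i) < degree \<phi>"
  shows "j \<le> n \<Longrightarrow> adic_coeff \<phi> (\<Sum>i\<le>n. c i * \<phi> ^ i) j = c j"
  using assms
proof (induction n arbitrary: c j)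
  case 0
  then show ?case by (simp add: adic_coeff_def mod_poly_less)
next
  case (Suc n)
  have "degree \<phi> > 0" using Suc.prems(2)[of 0] by simp
  then have nz: "\<phi> \<noteq> 0" by auto
  let ?g = "\<Sum>i\<le>n. c (Suc i) * \<phi> ^ i"
  have g: "(\<Sum>i\<le>Suc n. c i * \<phi> ^ i) = c 0 + \<phi> * ?g"
    by (subst sum.atMost_Suc_shift) (simp add: sum_distrib_left algebra_simps)
  show ?case
  proof (cases j)
    case 0
    then show ?thesis
      unfolding g using Suc.prems(2)[of 0] by (simp add: adic_coeff_def mod_poly_less)
  next
    case (Suc l)
    have "(c 0 + \<phi> * ?g) div \<phi> = ?g"
      using Suc.prems(2)[of 0] nz by (simp add: div_poly_less)
    then have "adic_coeff \<phi> (c 0 + \<phi> * ?g) j = adic_coeff \<phi> ?g l"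
      unfolding adic_coeff_def Suc by (simp add: poly_div_mult_right)
    also have "\<dots> = c (Suc l)"
      using Suc.IH[of l "\<lambda>i. c (Suc i)"] Suc.prems Suc by simp
    finally show ?thesis unfolding g Suc .
  qed
qed

definition first_stage ::
  "('a::field \<Rightarrow> 'g::linordered_ab_group_add vext) \<Rightarrow> 'g vext \<Rightarrow> 'a poly \<Rightarrow> 'g vext" where
  "first_stage V0 \<mu> g = Min ((\<lambda>i. V0 (coeff g i) + nmult i \<mu>) ` {..degree g})"

definition augment ::
  "('a::field poly \<Rightarrow> 'g::linordered_ab_group_add vext) \<Rightarrow> 'a poly \<Rightarrow> 'g vext
     \<Rightarrow> 'a poly \<Rightarrow> 'g vext" where
  "augment V \<phi> \<mu> g = Min ((\<lambda>i. V (adic_coeff \<phi> g i) + nmult i \<mu>) ` {..degree g})"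

text \<open>Here \<open>V\<close> is the previous stage, \<open>\<psi>\<close> its key polynomial, and \<open>\<phi>\<close> the new one. The
  minimality condition needs \<open>g \<noteq> 0\<close>, since every \<open>\<phi>\<close> divides \<open>0\<close> in \<open>V\<close> and \<open>degree 0 = 0\<close>.\<close>

definition key_polynomial ::
  "('a::field poly \<Rightarrow> 'g::linordered_ab_group_add vext) \<Rightarrow> 'a poly \<Rightarrow> 'a poly \<Rightarrow> 'g vext
     \<Rightarrow> bool" where
  "key_polynomial V \<psi> \<phi> \<mu> \<longleftrightarrow>
     equiv_irreducible V \<phi> \<and>
     (\<forall>g. g \<noteq> 0 \<and> dvd_in V \<phi> g \<longrightarrow> degree \<phi> \<le> degree g) \<and>
     lead_coeff \<phi> = 1 \<and> 0 < degree \<phi> \<and>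
     V \<phi> < \<mu> \<and>
     degree \<psi> \<le> degree \<phi> \<and>
     \<not> equiv_in V \<phi> \<psi>"

text \<open>A term \<open>a \<phi>\<^sub>1^m\<^sub>1 \<dots> \<phi>\<^sub>k^m\<^sub>k\<close> is given by its coefficient and its exponent vector \<open>m\<close>; an
  expansion is a finitely supported family of coefficients indexed by exponent vectors. Such
  expansions being unique, \<open>homogeneous\<close> below may ask for one.\<close>

definition key_term ::
  "(nat \<Rightarrow> 'a::field poly) \<Rightarrow> nat \<Rightarrow> 'a \<Rightarrow> (nat \<Rightarrow> nat) \<Rightarrow> 'a poly" where
  "key_term \<phi> k a m = smult a (\<Prod>i = 1..k. \<phi> i ^ m i)"

definition key_expansion ::
  "(nat \<Rightarrow> 'a::field poly) \<Rightarrow> nat \<Rightarrow> 'a poly \<Rightarrow> ((nat \<Rightarrow> nat) \<Rightarrow> 'a) \<Rightarrow> bool" where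
  "key_expansion \<phi> k g a \<longleftrightarrow>
     finite {m. a m \<noteq> 0} \<and>
     (\<forall>m. a m \<noteq> 0 \<longrightarrow>
        (\<forall>i. i \<notin> {1..k} \<longrightarrow> m i = 0) \<and>
        (\<forall>i\<in>{1..<k}. m i < degree (\<phi> (Suc i)) div degree (\<phi> i))) \<and>
     g = (\<Sum>m | a m \<noteq> 0. key_term \<phi> k (a m) m)"

definition homogeneous ::
  "(nat \<Rightarrow> 'a::field poly) \<Rightarrow> nat \<Rightarrow> ('a poly \<Rightarrow> 'g::linordered_ab_group_add vext)
     \<Rightarrow> 'a poly \<Rightarrow> bool" where
  "homogeneous \<phi> k V g \<longleftrightarrow>
     (\<exists>a. key_expansion \<phi> k g a \<and>
        (\<forall>m m'. a m \<noteq> 0 \<and> a m' \<noteq> 0 \<longrightarrow>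
           V (key_term \<phi> k (a m) m) = V (key_term \<phi> k (a m') m')))"

text \<open>Only exponents \<open>j\<close> up to the top exponent of the expansion of \<open>f\<close> count. This matters when
  \<open>V f = Infty\<close>: vanishing coefficients below the top one do count (for \<open>f = \<phi>\<close> the exponents
  are \<open>0\<close> and \<open>1\<close>), those above it do not.\<close>

definition proj_exponents ::
  "'a::field poly \<Rightarrow> 'a poly \<Rightarrow> ('a poly \<Rightarrow> 'g::linordered_ab_group_add vext) \<Rightarrow> nat set" where
  "proj_exponents f \<phi> V =
     {j. (\<exists>l\<ge>j. adic_coeff \<phi> f l \<noteq> 0) \<and> V f = V (adic_coeff \<phi> f j * \<phi> ^ j)}"

definition proj ::
  "'a::field poly \<Rightarrow> 'a poly \<Rightarrow> ('a poly \<Rightarrow> 'g::linordered_ab_group_add vext) \<Rightarrow> nat" where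
  "proj f \<phi> V = Max (proj_exponents f \<phi> V) - Min (proj_exponents f \<phi> V)"

definition approximant ::
  "('a::field \<Rightarrow> 'g::linordered_ab_group_add vext) \<Rightarrow> 'a poly \<Rightarrow> (nat \<Rightarrow> 'a poly)
     \<Rightarrow> (nat \<Rightarrow> 'g vext) \<Rightarrow> (nat \<Rightarrow> 'a poly \<Rightarrow> 'g vext) \<Rightarrow> nat \<Rightarrow> bool" where
  "approximant V0 f \<phi> \<mu> V k \<longleftrightarrow>
     1 \<le> k \<and>
     \<phi> 1 = [:0, 1:] \<and> V 1 = first_stage V0 (\<mu> 1) \<and>
     (\<forall>i\<in>{2..k}. key_polynomial (V (i - 1)) (\<phi> (i - 1)) (\<phi> i) (\<mu> i) \<and>
        homogeneous \<phi> (i - 1) (V (i - 1)) (\<phi> i) \<and>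
        V i = augment (V (i - 1)) (\<phi> i) (\<mu> i)) \<and>
     (\<forall>i\<in>{1..<k}. \<mu> i \<noteq> Infty) \<and>
     0 < proj f (\<phi> k) (V k)"

text \<open>The length \<open>len\<close> is infinite for an infinite sequence; the entries beyond \<open>len\<close>, and at
  index \<open>0\<close>, are irrelevant.\<close>

definition approximant_sequence ::
  "('a::field \<Rightarrow> 'g::linordered_ab_group_add vext) \<Rightarrow> 'a poly \<Rightarrow> enat \<Rightarrow> (nat \<Rightarrow> 'a poly)
     \<Rightarrow> (nat \<Rightarrow> 'g vext) \<Rightarrow> (nat \<Rightarrow> 'a poly \<Rightarrow> 'g vext) \<Rightarrow> bool" where
  "approximant_sequence V0 f len \<phi> \<mu> V \<longleftrightarrow>
     1 \<le> len \<and> (\<forall>k\<ge>1. enat k \<le> len \<longrightarrow> approximant V0 f \<phi> \<mu> V k)"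

text \<open>\<open>V0\<close> is a valuation of \<open>K\<close>, the later ones live on \<open>K[z]\<close>.\<close>

definition stage_group ::
  "('a::field \<Rightarrow> 'g::linordered_ab_group_add vext) \<Rightarrow> (nat \<Rightarrow> 'a poly \<Rightarrow> 'g vext) \<Rightarrow> nat \<Rightarrow> 'g set" where
  "stage_group V0 V i = (if i = 0 then value_group V0 else value_group (V i))"

end

theory Submission
  imports Defs
begin

text \<open>
  All stages are truncations of \<open>W\<close>: \<open>V\<^sub>k(g) = min\<^sub>i W(g\<^sub>i \<phi>\<^sub>k\<^sup>i)\<close>, where the \<open>g\<^sub>i\<close> are the
  \<open>\<phi>\<^sub>k\<close>-adic digits of \<open>g\<close>. Let \<open>n\<close> be the order of \<open>W(\<phi>\<^sub>k)\<close> modulo the group of values of \<open>W\<close> in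
  degrees below \<open>deg \<phi>\<^sub>k\<close>; it is finite, since otherwise the terms of the expansion of \<open>f\<close> would
  have distinct values and \<open>W(f)\<close> would be finite. In degrees below \<open>n deg \<phi>\<^sub>k\<close> the terms of an
  expansion have distinct values, so there \<open>V\<^sub>k = W\<close>. Some monomial \<open>c M\<close> in the earlier key
  polynomials has the value of \<open>\<phi>\<^sub>k\<^sup>n\<close>, and because the residue field of \<open>V\<^sub>0\<close> is algebraically
  closed, \<open>W\<close> has no larger residue field, so that \<open>c\<close> can be corrected by a unit to make
  \<open>\<phi>\<^sub>k\<^sub>+\<^sub>1 = \<phi>\<^sub>k\<^sup>n - c M\<close> satisfy \<open>W(\<phi>\<^sub>k\<^sub>+\<^sub>1) > W(\<phi>\<^sub>k\<^sup>n) = V\<^sub>k(\<phi>\<^sub>k\<^sub>+\<^sub>1)\<close>. Division with remainder then shows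
  that \<open>\<phi>\<^sub>k\<^sub>+\<^sub>1\<close> divides \<open>g \<noteq> 0\<close> in \<open>V\<^sub>k\<close> iff \<open>V\<^sub>k(g) < W(g)\<close>. As \<open>V\<^sub>k\<close> and \<open>W\<close> are multiplicative,
  this gives all properties of a key polynomial at once.
\<close>

subsection \<open>Values and ultrametric functions\<close>

lemma vext_add_eq_Infty [simp]:
  "u + v = Infty \<longleftrightarrow> u = Infty \<or> v = (Infty :: 'g::linordered_ab_group_add vext)"
  by (cases u; cases v) auto

lemma vext_Infty_add [simp]:
  "Infty + v = (Infty :: 'g::linordered_ab_group_add vext)"
  "v + Infty = (Infty :: 'g::linordered_ab_group_add vext)"
  by (cases v; simp)+

lemma vext_le_Infty [simp]: "v \<le> (Infty :: 'g::linorder vext)"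
  by (cases v) auto

lemma vext_Infty_le_iff [simp]: "Infty \<le> v \<longleftrightarrow> v = (Infty :: 'g::linorder vext)"
  by (cases v) auto

lemma vext_less_Infty_iff [simp]: "v < Infty \<longleftrightarrow> v \<noteq> (Infty :: 'g::linorder vext)"
  by (cases v) (auto simp: less_vext_def)

lemma vext_not_Infty_less [simp]: "\<not> Infty < (v :: 'g::linorder vext)"
  by (cases v) (auto simp: less_vext_def)

lemma Fin_less_iff [simp]: "Fin x < Fin y \<longleftrightarrow> x < (y :: 'g::linorder)"
  by (auto simp: less_vext_def)

lemma zero_vext_neq_Infty [simp]:
  "(0 :: 'g::linordered_ab_group_add vext) \<noteq> Infty" "Infty \<noteq> (0 :: 'g vext)"
  by (auto simp: zero_vext_def)

lemma vext_add_left_less_iff: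
  "u \<noteq> Infty \<Longrightarrow> u + v < u + w \<longleftrightarrow> v < (w :: 'g::linordered_ab_group_add vext)"
  by (cases u; cases v; cases w) auto

lemma vext_add_left_cancel:
  "u \<noteq> Infty \<Longrightarrow> u + v = u + w \<longleftrightarrow> v = (w :: 'g::linordered_ab_group_add vext)"
  by (cases u; cases v; cases w) auto

lemma vext_add_le_less_mono:
  fixes u :: "'g::linordered_ab_group_add vext"
  shows "u \<le> v \<Longrightarrow> w < x \<Longrightarrow> u \<noteq> Infty \<Longrightarrow> u + w < v + x"
  by (cases u; cases v; cases w; cases x) (auto intro: add_le_less_mono)

lemma nmult_0 [simp]: "nmult 0 \<mu> = 0"
  by (simp add: nmult_def)

lemma nmult_Suc: "nmult (Suc n) \<mu> = nmult n \<mu> + \<mu>"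
  by (simp add: nmult_def)

text \<open>Multiplicativity is kept out: truncations satisfy these axioms long before they are
  shown to be multiplicative.\<close>

locale ultrametric =
  fixes V :: "'b::idom \<Rightarrow> 'g::linordered_ab_group_add vext"
  assumes zero [simp]: "V 0 = Infty"
    and neg [simp]: "V (- a) = V a"
    and add_ge: "min (V a) (V b) \<le> V (a + b)"
begin

lemma ge_addI: "v \<le> V a \<Longrightarrow> v \<le> V b \<Longrightarrow> v \<le> V (a + b)"
  using add_ge[of a b] by (auto simp: min_def split: if_splits)

lemma gt_addI: "v < V a \<Longrightarrow> v < V b \<Longrightarrow> v < V (a + b)"
  using add_ge[of a b] by (auto simp: min_def split: if_splits)

lemma ge_diffI: "v \<le> V a \<Longrightarrow> v \<le> V b \<Longrightarrow> v \<le> V (a - b)"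
  using ge_addI[of v a "- b"] by simp

lemma gt_diffI: "v < V a \<Longrightarrow> v < V b \<Longrightarrow> v < V (a - b)"
  using gt_addI[of v a "- b"] by simp

lemma minus_commute: "V (a - b) = V (b - a)"
  using neg[of "a - b"] by simp

lemma add_eq: "V a < V b \<Longrightarrow> V (a + b) = V a"
proof (rule antisym)
  assume *: "V a < V b"
  show "V (a + b) \<le> V a"
  proof (rule ccontr)
    assume "\<not> V (a + b) \<le> V a"
    then have "V a < V (a + b - b)" using * by (intro gt_diffI) auto
    then show False by simp
  qed
  show "V a \<le> V (a + b)" using * by (intro ge_addI) auto
qed

lemma ge_sumI: "(\<And>s. s \<in> S \<Longrightarrow> v \<le> V (t s)) \<Longrightarrow> v \<le> V (sum t S)"
  by (induction S rule: infinite_finite_induct) (auto intro: ge_addI)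

lemma gt_sumI: "v \<noteq> Infty \<Longrightarrow> (\<And>s. s \<in> S \<Longrightarrow> v < V (t s)) \<Longrightarrow> v < V (sum t S)"
  by (induction S rule: infinite_finite_induct) (auto intro: gt_addI)

lemma sum_eq:
  assumes "finite S" "s \<in> S" "V (t s) \<noteq> Infty" "\<And>s'. s' \<in> S \<Longrightarrow> s' \<noteq> s \<Longrightarrow> V (t s) < V (t s')"
  shows "V (sum t S) = V (t s)"
proof -
  have "V (t s) < V (sum t (S - {s}))" using assms by (intro gt_sumI) auto
  then show ?thesis using add_eq[of "t s"] sum.remove[OF assms(1,2), of t] by metis
qed

text \<open>If the values differed, \<open>g - h\<close> would have the smaller of them as its
  value.\<close>

lemma eq_of_equiv: "equiv_in V g h \<Longrightarrow> V g = V h"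
proof (rule ccontr)
  assume "equiv_in V g h" and ne: "V g \<noteq> V h"
  then have *: "min (V g) (V h) < V (g - h)" by (auto simp: equiv_in_def)
  show False
  proof (cases "V g < V h")
    case True
    then show False using add_eq[of g "- h"] * by (auto simp: min_def split: if_splits)
  next
    case False
    then show False using add_eq[of h "- g"] * ne minus_commute[of g h]
      by (auto simp: min_def split: if_splits)
  qed
qed

end

text \<open>An arbitrary domain is allowed so that \<open>V0\<close> on the field and
  \<open>W\<close> on the polynomials are instances of the same axioms; for \<open>W\<close> they
  come from \<open>pseudo_valuation_iff\<close>.\<close>

locale pseudo_val =
  fixes W :: "'b::idom \<Rightarrow> 'g::linordered_ab_group_add vext"
  assumes zero: "W 0 = Infty" and one: "W 1 = 0" and mult: "W (a * b) = W a + W b"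
    and add_ge: "min (W a) (W b) \<le> W (a + b)"
begin

sublocale ultrametric W
proof
  have "W (- 1) + W (- 1) = 0" using mult[of "- 1" "- 1"] one by simp
  \<comment> \<open>A linearly ordered group has no element of order two.\<close>
  then have "W (- 1) = 0" by (cases "W (- 1)") (auto simp: zero_vext_def)
  then show "W (- a) = W a" for a using mult[of "- 1" a] by simp
qed (fact zero add_ge)+

declare one [simp]

lemma power: "W (a ^ n) = nmult n (W a)"
  by (induction n) (auto simp: mult nmult_Suc add.commute)

lemma power_neq_Infty: "W a \<noteq> Infty \<Longrightarrow> W (a ^ n) \<noteq> Infty"
  by (induction n) (auto simp: mult)

end

subsection \<open>Adic expansions\<close>

lemma adic_coeff_0 [simp]: "adic_coeff \<phi> 0 i = 0"
  by (simp add: adic_coeff_def)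

lemma adic_coeff_add: "adic_coeff \<phi> (g + h) i = adic_coeff \<phi> g i + adic_coeff \<phi> h i"
  by (simp add: adic_coeff_def poly_div_add_left poly_mod_add_left)

lemma adic_coeff_uminus: "adic_coeff \<phi> (- g) i = - adic_coeff \<phi> g i"
  by (simp add: adic_coeff_def poly_div_minus_left poly_mod_minus_left)

lemma adic_coeff_mod: "adic_coeff \<phi> g 0 = g mod \<phi>"
  by (simp add: adic_coeff_def)

lemma adic_coeff_reduced:
  "degree g < degree \<phi> \<Longrightarrow> adic_coeff \<phi> g i = (if i = 0 then g else 0)"
proof (cases i)
  case (Suc l)
  assume "degree g < degree \<phi>"
  then have "g div \<phi> = 0" by (rule div_poly_less)
  then show ?thesis using Suc by (simp add: adic_coeff_def poly_div_mult_right)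
qed (simp add: adic_coeff_def mod_poly_less)

lemma adic_coeff_mult_0 [simp]: "adic_coeff \<phi> (g * \<phi>) 0 = 0"
  by (simp add: adic_coeff_def)

lemma adic_coeff_mult_Suc:
  "\<phi> \<noteq> 0 \<Longrightarrow> adic_coeff \<phi> (g * \<phi>) (Suc l) = adic_coeff \<phi> g l"
  by (simp add: adic_coeff_def poly_div_mult_right)

lemma adic_coeff_eq_0:
  assumes "degree g < i * degree \<phi>"
  shows "adic_coeff \<phi> g i = 0"
proof -
  have "\<phi> \<noteq> 0" using assms by auto
  then have "degree (\<phi> ^ i) = i * degree \<phi>" by (rule degree_power_eq)
  then have "g div \<phi> ^ i = 0" using assms by (intro div_poly_less) simp
  then show ?thesis by (simp add: adic_coeff_def)
qed

text \<open>The tail stays a quotient, so that \<open>g\<close> can be cut at an arbitrary exponent,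
  as \<open>split_lowest\<close> does.\<close>

lemma adic_partial_expansion:
  "g = (\<Sum>i<n. adic_coeff \<phi> g i * \<phi> ^ i) + (g div \<phi> ^ n) * \<phi> ^ n"
proof (induction n)
  case (Suc n)
  have "g div \<phi> ^ n = (g div \<phi> ^ Suc n) * \<phi> + adic_coeff \<phi> g n"
    unfolding adic_coeff_def by (metis div_mult_mod_eq power_Suc2 poly_div_mult_right)
  then have "(g div \<phi> ^ n) * \<phi> ^ n
      = adic_coeff \<phi> g n * \<phi> ^ n + (g div \<phi> ^ Suc n) * \<phi> ^ Suc n"
    by (simp add: algebra_simps)
  with Suc show ?case by (simp add: algebra_simps)
qed simp

subsection \<open>Truncations\<close>

locale truncation = pseudo_val W
  for W :: "'a::field poly \<Rightarrow> 'g::linordered_ab_group_add vext" +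
  fixes \<phi> :: "'a poly"
  assumes degree_pos: "0 < degree \<phi>"
begin

text \<open>The digits are valued by \<open>W\<close> itself. That the previous stage gives them the
  same values is the content of \<open>stage_Suc\<close>.\<close>

definition T :: "'a poly \<Rightarrow> 'g vext" where
  "T = augment W \<phi> (W \<phi>)"

lemma phi_nz: "\<phi> \<noteq> 0"
  using degree_pos by auto

lemma T_eq_Min: "T g = Min ((\<lambda>i. W (adic_coeff \<phi> g i * \<phi> ^ i)) ` {..degree g})"
  by (simp add: T_def augment_def mult power)

text \<open>Digits beyond \<open>degree g\<close> vanish, so the minimum bounds the terms at all
  exponents and later arguments need not track the range.\<close>

lemma T_le: "T g \<le> W (adic_coeff \<phi> g i * \<phi> ^ i)"
proof (cases "i \<le> degree g")
  case True
  then show ?thesis unfolding T_eq_Min by (intro Min_le) auto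
next
  case False
  then have "i * 1 \<le> i * degree \<phi>" using degree_pos by (intro mult_le_mono2) simp
  with False have "adic_coeff \<phi> g i = 0" by (intro adic_coeff_eq_0) linarith
  then show ?thesis by simp
qed

lemma T_attained: "\<exists>i\<le>degree g. T g = W (adic_coeff \<phi> g i * \<phi> ^ i)"
proof -
  have "T g \<in> (\<lambda>i. W (adic_coeff \<phi> g i * \<phi> ^ i)) ` {..degree g}"
    unfolding T_eq_Min by (intro Min_in) auto
  then show ?thesis by auto
qed

lemma le_T_iff: "v \<le> T g \<longleftrightarrow> (\<forall>i. v \<le> W (adic_coeff \<phi> g i * \<phi> ^ i))"
  using T_attained[of g] T_le[of g] by (metis order_trans)

lemma T_eqI:
  assumes "\<And>i. v \<le> W (adic_coeff \<phi> g i * \<phi> ^ i)" "v = W (adic_coeff \<phi> g l * \<phi> ^ l)"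
  shows "T g = v"
  using assms T_le[of g l] by (intro antisym) (auto simp: le_T_iff)

sublocale T: ultrametric T
proof
  show "T 0 = Infty" by (intro T_eqI[where l = 0]) auto
  show "T (- a) = T a" for a
    by (simp add: T_def augment_def adic_coeff_uminus)
  show "min (T a) (T b) \<le> T (a + b)" for a b
    unfolding le_T_iff adic_coeff_add distrib_right
    by (intro allI ge_addI) (auto intro: min.coboundedI1 min.coboundedI2 T_le)
qed

text \<open>This is the ultrametric inequality for \<open>W\<close>, applied to the adic
  expansion.\<close>

lemma T_le_W: "T g \<le> W g"
  by (subst adic_expansion[OF degree_pos, of g]) (intro ge_sumI T_le)

lemma T_reduced: "degree g < degree \<phi> \<Longrightarrow> T g = W g"
  by (intro T_eqI[where l = 0]) (auto simp: adic_coeff_reduced)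

text \<open>Multiplication by \<open>\<phi>\<close> shifts the digits by one place.\<close>

lemma T_mult_phi: "T (g * \<phi>) = T g + W \<phi>"
proof (rule antisym)
  show "T g + W \<phi> \<le> T (g * \<phi>)"
    unfolding le_T_iff
  proof
    fix i
    show "T g + W \<phi> \<le> W (adic_coeff \<phi> (g * \<phi>) i * \<phi> ^ i)"
    proof (cases i)
      case (Suc l)
      have "T g + W \<phi> \<le> W (adic_coeff \<phi> g l * \<phi> ^ l) + W \<phi>"
        by (intro add_right_mono T_le)
      then show ?thesis
        using adic_coeff_mult_Suc[OF phi_nz, of g l]
        by (simp only: Suc mult power_Suc2 add.assoc)
    qed simp
  qed
  obtain i where "T g = W (adic_coeff \<phi> g i * \<phi> ^ i)" using T_attained by blast
  then have "T g + W \<phi> = W (adic_coeff \<phi> (g * \<phi>) (Suc i) * \<phi> ^ Suc i)"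
    using adic_coeff_mult_Suc[OF phi_nz, of g i] by (simp only: mult power_Suc2 add.assoc)
  then show "T (g * \<phi>) \<le> T g + W \<phi>" using T_le by metis
qed

lemma T_mult_phi_power: "T (g * \<phi> ^ n) = T g + W (\<phi> ^ n)"
proof (induction n)
  case (Suc n)
  have "T (g * \<phi> ^ Suc n) = T (g * \<phi> ^ n * \<phi>)" by (simp add: ac_simps)
  then show ?case using Suc by (simp only: T_mult_phi power_Suc2 mult add.assoc)
qed simp

lemma T_mult_phi_power_reduced: "degree g < degree \<phi> \<Longrightarrow> T (g * \<phi> ^ n) = W (g * \<phi> ^ n)"
  by (simp add: T_mult_phi_power T_reduced mult)

lemma T_phi_power: "T (\<phi> ^ n) = W (\<phi> ^ n)"
  using T_mult_phi_power_reduced[of 1 n] degree_pos by simp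

end

text \<open>These properties pass from one key polynomial to the next. As far as values are
  concerned, the polynomials of degree below \<open>degree \<phi>\<close> behave like a field under
  multiplication modulo \<open>\<phi>\<close>. The case \<open>W \<phi> = Infty\<close> stays
  allowed so that a last key polynomial \<open>f\<close> is covered.\<close>

locale value_truncation = truncation W \<phi>
  for W :: "'a::field poly \<Rightarrow> 'g::linordered_ab_group_add vext" and \<phi> :: "'a poly" +
  assumes W_reduced_fin: "degree a < degree \<phi> \<Longrightarrow> a \<noteq> 0 \<Longrightarrow> W a \<noteq> Infty"
    and W_mod: "degree a < degree \<phi> \<Longrightarrow> degree b < degree \<phi> \<Longrightarrow> W ((a * b) mod \<phi>) = W (a * b)"
    and W_inv: "degree a < degree \<phi> \<Longrightarrow> a \<noteq> 0 \<Longrightarrow> \<exists>b. degree b < degree \<phi> \<and> W (a * b) = 0"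

locale finite_truncation = value_truncation W \<phi>
  for W :: "'a::field poly \<Rightarrow> 'g::linordered_ab_group_add vext" and \<phi> :: "'a poly" +
  assumes W_phi_fin: "W \<phi> \<noteq> Infty"
begin

lemma W_phi_power_fin [simp]: "W (\<phi> ^ n) \<noteq> Infty"
  using W_phi_fin by (rule power_neq_Infty)

lemma T_eq_Infty_iff [simp]: "T g = Infty \<longleftrightarrow> g = 0"
proof
  assume *: "T g = Infty"
  have "adic_coeff \<phi> g i = 0" for i
  proof (rule ccontr)
    assume "adic_coeff \<phi> g i \<noteq> 0"
    then have "W (adic_coeff \<phi> g i * \<phi> ^ i) \<noteq> Infty"
      using W_reduced_fin[OF degree_adic_coeff[OF degree_pos]] by (simp add: mult)
    then show False using T_le[of g i] * by simp
  qed
  then show "g = 0" using adic_expansion[OF degree_pos, of g] by simp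
qed simp

text \<open>For a digit \<open>b\<close>, write \<open>a * b = q * \<phi> + r\<close>. By
  \<open>W_mod\<close> the remainder has the value of the product, hence \<open>q * \<phi>\<close>
  has at least that value, and \<open>q\<close> is again a digit. The general case follows digit by
  digit.\<close>

lemma T_mult_reduced_ge:
  assumes a: "degree a < degree \<phi>"
  shows "W a + T h \<le> T (a * h)"
proof -
  have ab: "W a + W b \<le> T (a * b)" if b: "degree b < degree \<phi>" for b
  proof -
    define q r where "q = (a * b) div \<phi>" and "r = (a * b) mod \<phi>"
    have ab: "a * b = q * \<phi> + r" by (simp add: q_def r_def)
    have r: "W r = W a + W b" using W_mod[OF a b] by (simp add: r_def mult)
    have dr: "degree r < degree \<phi>" using degree_pos phi_nz degree_mod_less' unfolding r_def
      by (metis degree_0)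
    have dq: "degree q < degree \<phi>"
    proof (cases "q = 0")
      case False
      have "degree (q * \<phi>) = degree q + degree \<phi>" using False phi_nz by (simp add: degree_mult_eq)
      moreover have "q * \<phi> = a * b - r" using ab by simp
      moreover have "degree (a * b - r) < degree \<phi> + degree \<phi>"
      proof (rule degree_diff_less)
        show "degree (a * b) < degree \<phi> + degree \<phi>" using degree_mult_le[of a b] a b by linarith
        show "degree r < degree \<phi> + degree \<phi>" using dr by simp
      qed
      ultimately show ?thesis by simp
    qed (use degree_pos in simp)
    have "W a + W b \<le> W (q * \<phi>)"
    proof -
      have "W a + W b \<le> W (a * b - r)" using r by (intro ge_diffI) (auto simp: mult)
      then show ?thesis using ab by simp
    qed
    then show ?thesis unfolding ab
      using T_mult_phi_power_reduced[OF dq, of 1] T_reduced[OF dr] r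
      by (intro T.ge_addI) auto
  qed
  have "a * h = (\<Sum>i\<le>degree h. a * adic_coeff \<phi> h i * \<phi> ^ i)"
    by (subst adic_expansion[OF degree_pos, of h]) (simp add: sum_distrib_left mult.assoc)
  moreover have "W a + T h \<le> T (a * adic_coeff \<phi> h i * \<phi> ^ i)" for i
  proof -
    have "W a + T h \<le> W a + (W (adic_coeff \<phi> h i) + W (\<phi> ^ i))"
      using T_le[of h i] by (intro add_left_mono) (simp add: mult)
    also have "\<dots> \<le> T (a * adic_coeff \<phi> h i) + W (\<phi> ^ i)"
      using ab[OF degree_adic_coeff[OF degree_pos], of h i] by (simp add: add_right_mono flip: add.assoc)
    finally show ?thesis by (simp add: T_mult_phi_power)
  qed
  ultimately show ?thesis by (simp add: T.ge_sumI)
qed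

lemma T_mult_ge: "T g + T h \<le> T (g * h)"
proof -
  have "g * h = (\<Sum>i\<le>degree g. adic_coeff \<phi> g i * h * \<phi> ^ i)"
    by (subst adic_expansion[OF degree_pos, of g]) (simp only: sum_distrib_right mult.assoc mult.commute[of h])
  moreover have "T g + T h \<le> T (adic_coeff \<phi> g i * h * \<phi> ^ i)" for i
  proof -
    have "T g + T h \<le> (W (adic_coeff \<phi> g i) + W (\<phi> ^ i)) + T h"
      using T_le[of g i] by (intro add_right_mono) (simp add: mult)
    also have "\<dots> = (W (adic_coeff \<phi> g i) + T h) + W (\<phi> ^ i)" by (simp add: ac_simps)
    also have "\<dots> \<le> T (adic_coeff \<phi> g i * h) + W (\<phi> ^ i)"
      by (intro add_right_mono T_mult_reduced_ge degree_adic_coeff degree_pos)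
    finally show ?thesis by (simp add: T_mult_phi_power)
  qed
  ultimately show ?thesis by (simp add: T.ge_sumI)
qed

text \<open>Cutting \<open>g\<close> at the lowest exponent where the minimum is attained reduces the
  multiplicativity of \<open>T\<close> to that of \<open>W\<close> on the lowest digits.\<close>

lemma split_lowest:
  assumes "g \<noteq> 0"
  obtains A B i where "g = A + B * \<phi> ^ i" "T g < T A" "T (B * \<phi> ^ i) = T g"
    "T B = W (B mod \<phi>)"
proof -
  define P where "P i \<longleftrightarrow> T g = W (adic_coeff \<phi> g i * \<phi> ^ i)" for i
  have "\<exists>i. P i" using T_attained[of g] by (auto simp: P_def)
  then obtain i where i: "P i" "\<And>l. l < i \<Longrightarrow> \<not> P l" by (metis exists_least_iff)
  define A where "A = (\<Sum>l<i. adic_coeff \<phi> g l * \<phi> ^ l)"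
  define B where "B = g div \<phi> ^ i"
  have g: "g = A + B * \<phi> ^ i" unfolding A_def B_def by (rule adic_partial_expansion)
  have "T g < T A" unfolding A_def
  proof (rule T.gt_sumI)
    fix l assume "l \<in> {..<i}"
    then have "T g < W (adic_coeff \<phi> g l * \<phi> ^ l)"
      using i(2)[of l] T_le[of g l] by (auto simp: P_def)
    then show "T g < T (adic_coeff \<phi> g l * \<phi> ^ l)"
      by (simp add: T_mult_phi_power_reduced degree_adic_coeff degree_pos)
  qed (use assms in simp)
  moreover from this have TB: "T (B * \<phi> ^ i) = T g"
    using T.add_eq[of g "- A"] g by (simp add: algebra_simps)
  moreover have "T B = W (B mod \<phi>)"
  proof -
    have "adic_coeff \<phi> g i = B mod \<phi>" by (simp add: adic_coeff_def B_def)
    then have "W (\<phi> ^ i) + T B = W (\<phi> ^ i) + W (B mod \<phi>)"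
      using i(1) TB by (simp add: P_def mult T_mult_phi_power add.commute)
    then show ?thesis by (simp add: vext_add_left_cancel)
  qed
  ultimately show ?thesis using that g by blast
qed

lemma T_mult: "T (g * h) = T g + T h"
proof (cases "g = 0 \<or> h = 0")
  case False
  obtain A B i where g: "g = A + B * \<phi> ^ i" "T g < T A" "T (B * \<phi> ^ i) = T g"
    "T B = W (B mod \<phi>)" using False by (blast intro: split_lowest)
  obtain A' B' i' where h: "h = A' + B' * \<phi> ^ i'" "T h < T A'" "T (B' * \<phi> ^ i') = T h"
    "T B' = W (B' mod \<phi>)" using False by (blast intro: split_lowest)
  have deg: "degree (x mod \<phi>) < degree \<phi>" for x
    using degree_pos degree_mod_less' phi_nz by (metis degree_0)
  \<comment> \<open>It suffices to look at the lowest digit of \<open>B * B'\<close>, whose value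
    \<open>W_mod\<close> determines.\<close>
  have "T (B * B') \<le> T B + T B'"
  proof -
    have "T (B * B') \<le> W (B * B' mod \<phi>)" using T_le[of "B * B'" 0] by (simp add: adic_coeff_mod)
    also have "B * B' mod \<phi> = (B mod \<phi>) * (B' mod \<phi>) mod \<phi>" by (simp add: mod_mult_eq)
    also have "W \<dots> = T B + T B'" using W_mod[OF deg deg] by (simp add: mult g h)
    finally show ?thesis .
  qed
  then have "T (B * B') + (W (\<phi> ^ i) + W (\<phi> ^ i')) \<le> T B + T B' + (W (\<phi> ^ i) + W (\<phi> ^ i'))"
    by (rule add_right_mono)
  also have "\<dots> = (T B + W (\<phi> ^ i)) + (T B' + W (\<phi> ^ i'))" by (simp only: ac_simps)
  also have "\<dots> = T g + T h" using g(3) h(3) by (simp only: T_mult_phi_power)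
  finally have 1: "T (B * B' * \<phi> ^ (i + i')) \<le> T g + T h"
    by (subst T_mult_phi_power) (simp only: power_add mult)
  \<comment> \<open>The other parts of \<open>g * h\<close> have values above
    \<open>T g + T h\<close>, so they cannot compensate this one.\<close>
  have gh: "B * B' * \<phi> ^ (i + i') = g * h - (A * h + B * \<phi> ^ i * A')"
    unfolding g(1) h(1) by (simp add: algebra_simps power_add)
  have 2: "T g + T h < T (A * h)"
  proof -
    have "T g + T h < T A + T h"
      using g(2) False vext_add_left_less_iff[of "T h" "T g" "T A"] by (simp add: add.commute)
    also have "\<dots> \<le> T (A * h)" by (rule T_mult_ge)
    finally show ?thesis .
  qed
  have 3: "T g + T h < T (B * \<phi> ^ i * A')"
  proof -
    have "T g + T h < T (B * \<phi> ^ i) + T A'"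
      using g(3) h(2) False vext_add_left_less_iff[of "T g" "T h" "T A'"] by simp
    also have "\<dots> \<le> T (B * \<phi> ^ i * A')" by (rule T_mult_ge)
    finally show ?thesis .
  qed
  have "\<not> T g + T h < T (g * h)"
  proof
    assume "T g + T h < T (g * h)"
    then have "T g + T h < T (B * B' * \<phi> ^ (i + i'))"
      unfolding gh using 2 3 by (intro T.gt_diffI T.gt_addI)
    with 1 show False by simp
  qed
  with T_mult_ge show ?thesis by (metis order_le_less)
qed auto

end

section \<open>The group of values below the degree of the key polynomial\<close>

context value_truncation
begin

lemma degree_mod: "degree (g mod \<phi>) < degree \<phi>"
  using degree_pos degree_mod_less' phi_nz by (metis degree_0)

lemma reduced_mult:
  assumes "degree a < degree \<phi>" "degree b < degree \<phi>"
  shows "\<exists>d. degree d < degree \<phi> \<and> W d = W (a * b)"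
  using W_mod[OF assms] degree_mod by blast

lemma reduced_power:
  assumes "degree a < degree \<phi>"
  shows "\<exists>d. degree d < degree \<phi> \<and> W d = W (a ^ n)"
proof (induction n)
  case 0
  then show ?case using degree_pos by (intro exI[of _ 1]) simp
next
  case (Suc n)
  then obtain d where "degree d < degree \<phi>" "W d = W (a ^ n)" by blast
  then show ?case using reduced_mult[OF assms, of d] by (simp add: mult)
qed

text \<open>For the key polynomial of index \<open>Suc i\<close> this is the value group of stage
  \<open>i\<close>, and for \<open>\<phi> = z\<close> that of \<open>V0\<close>; see
  \<open>stage_group_eq\<close>.\<close>

definition reduced_values :: "'g set" where
  "reduced_values = {x. \<exists>a. degree a < degree \<phi> \<and> W a = Fin x}"

lemma reduced_values_0: "0 \<in> reduced_values"
  using degree_pos one by (auto simp: reduced_values_def zero_vext_def intro!: exI[of _ 1])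

lemma reduced_values_add: "x \<in> reduced_values \<Longrightarrow> y \<in> reduced_values \<Longrightarrow> x + y \<in> reduced_values"
  using reduced_mult by (fastforce simp: reduced_values_def mult)

lemma reduced_values_uminus:
  assumes "x \<in> reduced_values"
  shows "- x \<in> reduced_values"
proof -
  obtain a where a: "degree a < degree \<phi>" "W a = Fin x"
    using assms by (auto simp: reduced_values_def)
  then have "a \<noteq> 0" by auto
  then obtain b where b: "degree b < degree \<phi>" "W (a * b) = 0" using W_inv[OF a(1)] by blast
  from b(2) have "W b = Fin (- x)"
    using a(2) by (cases "W b") (auto simp: mult zero_vext_def eq_neg_iff_add_eq_0 add.commute)
  with b(1) show ?thesis by (auto simp: reduced_values_def)
qed

lemma reduced_values_diff: "x \<in> reduced_values \<Longrightarrow> y \<in> reduced_values \<Longrightarrow> x - y \<in> reduced_values"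
  using reduced_values_add[of x "- y"] reduced_values_uminus by simp

text \<open>The values already form a group, so the differences in \<open>value_group\<close> add
  nothing.\<close>

lemma value_group_eq_reduced_values:
  assumes *: "\<And>x. (\<exists>g. V g = Fin x) \<longleftrightarrow> x \<in> reduced_values"
  shows "value_group V = reduced_values"
proof -
  have "value_group V = {x - y | x y. x \<in> reduced_values \<and> y \<in> reduced_values}"
    unfolding value_group_def using * by blast
  also have "\<dots> = reduced_values"
  proof safe
    fix x assume "x \<in> reduced_values"
    then show "\<exists>y z. x = y - z \<and> y \<in> reduced_values \<and> z \<in> reduced_values"
      using reduced_values_0 by (intro exI[of _ x] exI[of _ 0]) simp
  qed (rule reduced_values_diff)
  finally show ?thesis .
qed

end

section \<open>Terms of equal minimal value\<close>

context finite_truncation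
begin

text \<open>A minimum attained only once would be the value of the whole sum under
  \<open>W\<close>.\<close>

lemma two_minimal_exponents:
  assumes "T g \<noteq> W g"
  obtains i l where "i < l" "T g = W (adic_coeff \<phi> g i * \<phi> ^ i)"
    "T g = W (adic_coeff \<phi> g l * \<phi> ^ l)"
proof -
  let ?t = "\<lambda>i. adic_coeff \<phi> g i * \<phi> ^ i"
  have g: "g \<noteq> 0" using assms by auto
  obtain i where i: "i \<le> degree g" "T g = W (?t i)" using T_attained by blast
  have "\<exists>l. l \<noteq> i \<and> T g = W (?t l)"
  proof (rule ccontr)
    assume "\<not> ?thesis"
    then have "W (?t i) < W (?t l)" if "l \<noteq> i" for l
      using that T_le[of g l] i(2) by (metis order_le_less)
    then have "W (\<Sum>i\<le>degree g. ?t i) = W (?t i)"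
      using i g T_eq_Infty_iff[of g] by (intro sum_eq) auto
    then show False using i(2) assms by (simp flip: adic_expansion[OF degree_pos])
  qed
  then obtain l where "l \<noteq> i" "T g = W (?t l)" by blast
  then show ?thesis using that i(2) by (metis linorder_neqE_nat)
qed

text \<open>Cancelling \<open>\<phi> ^ i\<close> gives \<open>W (\<phi> ^ (l - i))\<close> as the
  difference of the values of \<open>a\<close> and \<open>b\<close>, and an inverse value of
  \<open>b\<close> realises it by a digit.\<close>

lemma value_ratio:
  assumes "degree a < degree \<phi>" "degree b < degree \<phi>" "b \<noteq> 0" "i < l"
    and eq: "W (a * \<phi> ^ i) = W (b * \<phi> ^ l)"
  shows "\<exists>d. degree d < degree \<phi> \<and> W d = W (\<phi> ^ (l - i))"
proof -
  have "\<phi> ^ l = \<phi> ^ i * \<phi> ^ (l - i)" using assms(4) by (simp flip: power_add)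
  then have "W (\<phi> ^ i) + W a = W (\<phi> ^ i) + (W b + W (\<phi> ^ (l - i)))"
    using eq by (simp only: mult ac_simps)
  then have Wa: "W a = W b + W (\<phi> ^ (l - i))" by (simp add: vext_add_left_cancel)
  obtain b' where b': "degree b' < degree \<phi>" "W (b * b') = 0" using W_inv assms(2,3) by blast
  have "W (a * b') = W (b * b') + W (\<phi> ^ (l - i))" by (simp add: mult Wa ac_simps)
  then show ?thesis using reduced_mult[OF assms(1) b'(1)] b'(2) by simp
qed

text \<open>Since \<open>T f\<close> is finite and \<open>W f\<close> is not, two terms of the
  expansion of \<open>f\<close> have the same value. This yields the finite order of the value of
  \<open>\<phi>\<close> modulo \<open>reduced_values\<close>.\<close>

lemma ex_value_order:
  assumes "f \<noteq> 0" "W f = Infty"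
  shows "\<exists>n>0. \<exists>d. degree d < degree \<phi> \<and> W d = W (\<phi> ^ n)"
proof -
  have ne: "T f \<noteq> Infty" using assms by simp
  then obtain i l where il: "i < l" "T f = W (adic_coeff \<phi> f i * \<phi> ^ i)"
    "T f = W (adic_coeff \<phi> f l * \<phi> ^ l)" using two_minimal_exponents[of f] assms(2) by metis
  then have "adic_coeff \<phi> f l \<noteq> 0" using ne by auto
  then show ?thesis
    using value_ratio[OF degree_adic_coeff degree_adic_coeff, OF degree_pos degree_pos _ il(1)] il
    by (metis zero_less_diff)
qed

text \<open>The two terms of equal minimal value give two elements of \<open>proj_exponents\<close>,
  a set bounded by \<open>degree f\<close>, so that its maximum and minimum behave as
  expected.\<close>

lemma proj_pos:
  assumes "f \<noteq> 0" "W f = Infty"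
  shows "0 < proj f \<phi> T"
proof -
  have ne: "T f \<noteq> Infty" using assms by simp
  then obtain i l where il: "i < l" "T f = W (adic_coeff \<phi> f i * \<phi> ^ i)"
    "T f = W (adic_coeff \<phi> f l * \<phi> ^ l)" using two_minimal_exponents[of f] assms(2) by metis
  have T: "T (adic_coeff \<phi> f j * \<phi> ^ j) = W (adic_coeff \<phi> f j * \<phi> ^ j)" for j
    by (simp add: T_mult_phi_power_reduced degree_adic_coeff degree_pos)
  define E where "E = proj_exponents f \<phi> T"
  have bound: "j \<le> degree f" if "adic_coeff \<phi> f j \<noteq> 0" for j
  proof (rule ccontr)
    assume *: "\<not> j \<le> degree f"
    have "j * 1 \<le> j * degree \<phi>" using degree_pos by (intro mult_le_mono2) simp
    with * have "adic_coeff \<phi> f j = 0" by (intro adic_coeff_eq_0) linarith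
    with that show False by simp
  qed
  have "E \<subseteq> {..degree f}"
    unfolding E_def proj_exponents_def using bound order_trans by fastforce
  then have fin: "finite E" by (rule finite_subset) simp
  have "adic_coeff \<phi> f l \<noteq> 0" using il ne by auto
  then have "i \<in> E" "l \<in> E"
    unfolding E_def proj_exponents_def T using il by (auto intro: exI[of _ l])
  then have "Min E \<le> i" "l \<le> Max E" using fin by auto
  then show ?thesis using il(1) unfolding proj_def E_def[symmetric] by simp
qed

end

subsection \<open>Key polynomials over a truncation\<close>

text \<open>One step from \<open>\<phi>\<close> to \<open>\<phi> ^ n - c\<close>. Here
  \<open>n\<close> is the order of the value of \<open>\<phi>\<close> modulo
  \<open>reduced_values\<close>, and \<open>c\<close> may be any digit cancelling
  \<open>\<phi> ^ n\<close> to first order; its monomial shape enters only in the construction of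
  the sequence.\<close>

locale key_step = finite_truncation W \<phi>
  for W :: "'a::field poly \<Rightarrow> 'g::linordered_ab_group_add vext" and \<phi> :: "'a poly" +
  fixes c :: "'a poly" and n :: nat
  assumes n_pos: "0 < n"
    and degree_c: "degree c < degree \<phi>"
    and W_c: "W c = W (\<phi> ^ n)"
    and n_minimal: "0 < m \<Longrightarrow> m < n \<Longrightarrow> degree a < degree \<phi> \<Longrightarrow> W a \<noteq> W (\<phi> ^ m)"
    and W_psi: "W (\<phi> ^ n) < W (\<phi> ^ n - c)"
begin

abbreviation \<psi> :: "'a poly" where "\<psi> \<equiv> \<phi> ^ n - c"

lemma degree_power_phi: "degree (\<phi> ^ n) = n * degree \<phi>"
  by (rule degree_power_eq[OF phi_nz])

lemma degree_c_less: "degree c < degree (\<phi> ^ n)"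
proof -
  have "1 * degree \<phi> \<le> n * degree \<phi>" using n_pos by (intro mult_le_mono1) simp
  then show ?thesis using degree_c degree_power_phi by linarith
qed

lemma degree_psi: "degree \<psi> = n * degree \<phi>"
  using degree_add_eq_left[of "- c" "\<phi> ^ n"] degree_c_less degree_power_phi by simp

lemma lead_coeff_psi: "lead_coeff \<phi> = 1 \<Longrightarrow> lead_coeff \<psi> = 1"
  using lead_coeff_add_le[of "- c" "\<phi> ^ n"] degree_c_less lead_coeff_power[of \<phi> n]
  by (simp add: add.commute)

lemma degree_psi_pos: "0 < degree \<psi>"
  using degree_psi degree_pos n_pos by simp

text \<open>A difference would give two minimal exponents \<open>i < l\<close>. The degree forces
  \<open>l < n\<close>, so \<open>l - i\<close> would contradict the minimality of
  \<open>n\<close>.\<close>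

lemma T_below:
  assumes "degree g < degree \<psi>"
  shows "T g = W g"
proof (rule ccontr)
  assume ne: "T g \<noteq> W g"
  then have "T g \<noteq> Infty" by auto
  obtain i l where il: "i < l" "T g = W (adic_coeff \<phi> g i * \<phi> ^ i)"
    "T g = W (adic_coeff \<phi> g l * \<phi> ^ l)" using two_minimal_exponents[OF ne] .
  then have nz: "adic_coeff \<phi> g l \<noteq> 0" using \<open>T g \<noteq> Infty\<close> by auto
  then have "\<not> degree g < l * degree \<phi>" using adic_coeff_eq_0 by blast
  then have "l * degree \<phi> < n * degree \<phi>" using assms degree_psi by linarith
  then have "l < n" by simp
  moreover obtain d where "degree d < degree \<phi>" "W d = W (\<phi> ^ (l - i))"
    using value_ratio[OF degree_adic_coeff degree_adic_coeff, OF degree_pos degree_pos nz il(1)] il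
    by metis
  ultimately show False using n_minimal[of "l - i" d] il(1) by simp
qed

lemma psi_mod: "\<psi> mod \<phi> = - c"
proof -
  have "\<psi> = - c + \<phi> * \<phi> ^ (n - 1)" using n_pos by (simp flip: power_Suc)
  then have "\<psi> mod \<phi> = - c mod \<phi>" by (simp only: mod_mult_self2)
  then show ?thesis using degree_c by (simp add: mod_poly_less)
qed

lemma T_psi: "T \<psi> = W (\<phi> ^ n)"
proof (rule antisym)
  show "T \<psi> \<le> W (\<phi> ^ n)"
    using T_le[of \<psi> 0] by (simp add: adic_coeff_mod psi_mod W_c)
  show "W (\<phi> ^ n) \<le> T \<psi>"
    by (intro T.ge_diffI) (simp_all add: T_phi_power T_reduced degree_c W_c)
qed

text \<open>Both \<open>\<psi>\<close> and \<open>\<psi> - \<phi>\<close> have the lowest digit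
  \<open>- c\<close>, so the difference gains no value over \<open>\<psi>\<close>. This covers
  \<open>n = 1\<close>, where the degrees of \<open>\<phi>\<close> and \<open>\<psi>\<close>
  agree.\<close>

lemma psi_not_equiv: "\<not> equiv_in T \<psi> \<phi>"
proof
  assume *: "equiv_in T \<psi> \<phi>"
  have "T (\<psi> - \<phi>) \<le> W ((\<psi> - \<phi>) mod \<phi>)" using T_le[of "\<psi> - \<phi>" 0] by (simp add: adic_coeff_mod)
  also have "(\<psi> - \<phi>) mod \<phi> = - c" using psi_mod by simp
  finally have "T (\<psi> - \<phi>) \<le> T \<psi>" using T_psi W_c by simp
  then show False
    using * T.eq_of_equiv[OF *] psi_mod phi_nz by (auto simp: equiv_in_def)
qed

text \<open>The strict gap between \<open>T\<close> and \<open>W\<close> at \<open>\<psi>\<close>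
  survives multiplication because both are multiplicative.\<close>

lemma T_less_W_mult_psi: "q \<noteq> 0 \<Longrightarrow> T (q * \<psi>) < W (q * \<psi>)"
  unfolding T_mult mult using T_psi W_psi T_le_W
  by (intro vext_add_le_less_mono) auto

text \<open>If the remainder \<open>r\<close> does not exceed \<open>g\<close> in value, neither
  does it exceed the multiple \<open>g - r\<close> of \<open>\<psi>\<close>. Under \<open>W\<close>
  that multiple lies strictly higher, so \<open>r\<close> alone decides \<open>W g\<close>.\<close>

lemma mod_psi_le:
  assumes "T (g mod \<psi>) \<le> T g"
  shows "T g = W g" "W (g mod \<psi>) = W g"
proof -
  define q r where "q = g div \<psi>" and "r = g mod \<psi>"
  have g: "g = r + q * \<psi>" unfolding q_def r_def by (rule mod_div_mult_eq[symmetric])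
  have "degree r < degree \<psi>"
    unfolding r_def using degree_psi_pos degree_mod_less' by (metis degree_0 less_irrefl)
  then have Tr: "T r = W r" by (rule T_below)
  have rg: "T r \<le> T g" using assms by (simp add: r_def)
  have "W r = W g"
  proof (cases "q = 0")
    case False
    have "T r \<le> T (g - r)" using rg by (intro T.ge_diffI) auto
    also have "g - r = q * \<psi>" using g by simp
    finally have "W r < W (q * \<psi>)" using T_less_W_mult_psi[OF False] Tr by simp
    then show ?thesis using add_eq g by simp
  qed (use g in simp)
  then show "T g = W g" "W (g mod \<psi>) = W g"
    using rg Tr T_le_W[of g] by (auto simp: r_def)
qed

text \<open>Here the multiple of \<open>\<psi>\<close> carries the value \<open>T g\<close>, and
  passing to \<open>W\<close> raises it strictly.\<close>

lemma T_less_W: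
  assumes "T g < T (g mod \<psi>)"
  shows "T g < W g"
proof -
  define q r where "q = g div \<psi>" and "r = g mod \<psi>"
  have g: "g = q * \<psi> + r" unfolding q_def r_def by (rule div_mult_mod_eq[symmetric])
  have r: "T g < T r" using assms by (simp add: r_def)
  have "T (q * \<psi>) = T g" using T.add_eq[of g "- r"] r g by simp
  moreover have "q \<noteq> 0" using g r by auto
  ultimately have "T g < W (q * \<psi>)" using T_less_W_mult_psi by metis
  moreover have "T g < W r" using r T_le_W[of r] by simp
  ultimately show ?thesis by (subst g) (rule gt_addI)
qed

text \<open>This turns the conditions on key polynomials into statements about where
  \<open>T\<close> and \<open>W\<close> differ. If \<open>g \<noteq> 0\<close> is equivalent to
  \<open>h * \<psi>\<close>, that product and the difference both have \<open>W\<close>-value above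
  \<open>T g\<close>. Conversely, by \<open>mod_psi_le\<close> a gap forces the remainder above
  \<open>T g\<close>.\<close>

lemma dvd_in_psi_iff: "dvd_in T \<psi> g \<longleftrightarrow> g = 0 \<or> T g < W g"
proof
  assume "dvd_in T \<psi> g"
  then obtain h where h: "equiv_in T g (h * \<psi>)" by (auto simp: dvd_in_def)
  show "g = 0 \<or> T g < W g"
  proof (rule ccontr)
    assume *: "\<not> (g = 0 \<or> T g < W g)"
    have eq: "T g = T (h * \<psi>)" using T.eq_of_equiv[OF h] .
    have "T g \<noteq> Infty" using * by simp
    then have h0: "h \<noteq> 0" using eq by auto
    have "T g < T (g - h * \<psi>)" using h eq \<open>T g \<noteq> Infty\<close> by (auto simp: equiv_in_def)
    also have "\<dots> \<le> W (g - h * \<psi>)" by (rule T_le_W)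
    finally have "T g < W (g - h * \<psi> + h * \<psi>)"
      using T_less_W_mult_psi[OF h0] eq by (intro gt_addI) auto
    then show False using * by simp
  qed
next
  assume *: "g = 0 \<or> T g < W g"
  show "dvd_in T \<psi> g"
  proof (cases "g = 0")
    case True
    then show ?thesis unfolding dvd_in_def by (intro exI[of _ 0]) (simp add: equiv_in_def)
  next
    case False
    then have "T g < T (g mod \<psi>)" using * mod_psi_le(1)[of g] by force
    then have "equiv_in T g (g div \<psi> * \<psi>)"
      by (auto simp: equiv_in_def minus_div_mult_eq_mod min_def)
    then show ?thesis by (auto simp: dvd_in_def)
  qed
qed

text \<open>As \<open>T\<close> and \<open>W\<close> are multiplicative, a gap at a product forces a
  gap at a factor. Minimality of the degree holds because \<open>T_below\<close> leaves no gap below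
  \<open>degree \<psi>\<close>.\<close>

lemma key_polynomial_psi:
  assumes "lead_coeff \<phi> = 1"
  shows "key_polynomial T \<phi> \<psi> (W \<psi>)"
  unfolding key_polynomial_def
proof (intro conjI allI impI)
  show "equiv_irreducible T \<psi>"
    unfolding equiv_irreducible_def dvd_in_psi_iff
  proof (intro allI impI)
    fix a b assume "a * b = 0 \<or> T (a * b) < W (a * b)"
    then show "(a = 0 \<or> T a < W a) \<or> (b = 0 \<or> T b < W b)"
      using T_le_W[of a] T_le_W[of b] by (auto simp: T_mult mult order_le_less)
  qed
  show "degree \<psi> \<le> degree g" if "g \<noteq> 0 \<and> dvd_in T \<psi> g" for g
    using that T_below[of g] unfolding dvd_in_psi_iff by force
  show "degree \<phi> \<le> degree \<psi>" using degree_psi n_pos by simp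
qed (use lead_coeff_psi assms degree_psi_pos T_psi W_psi psi_not_equiv in auto)

text \<open>Each block of \<open>n\<close> factors \<open>\<phi>\<close> can be traded for a factor
  \<open>c\<close> of the same value, which leaves the exponent modulo \<open>n\<close>.\<close>

lemma T_value:
  assumes "g \<noteq> 0"
  shows "\<exists>d s. degree d < degree \<phi> \<and> s < n \<and> T g = W (d * \<phi> ^ s)"
proof -
  obtain i where i: "T g = W (adic_coeff \<phi> g i * \<phi> ^ i)" using T_attained by blast
  obtain e where e: "degree e < degree \<phi>" "W e = W (c ^ (i div n))"
    using reduced_power[OF degree_c] by blast
  obtain d where d: "degree d < degree \<phi>" "W d = W (adic_coeff \<phi> g i * e)"
    using reduced_mult[OF degree_adic_coeff[OF degree_pos] e(1)] by blast
  have "W (c ^ (i div n)) = W ((\<phi> ^ n) ^ (i div n))" by (simp only: power W_c)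
  moreover have "\<phi> ^ i = (\<phi> ^ n) ^ (i div n) * \<phi> ^ (i mod n)" by (simp flip: power_mult power_add)
  ultimately have "W (\<phi> ^ i) = W e + W (\<phi> ^ (i mod n))" using e(2) by (simp only: mult)
  then have "T g = W (d * \<phi> ^ (i mod n))" using i d(2) by (simp only: mult add.assoc)
  then show ?thesis using d(1) n_pos by (meson mod_less_divisor)
qed

lemma degree_reduced_times_power:
  assumes "degree d < degree \<phi>" "s < n"
  shows "degree (d * \<phi> ^ s) < degree \<psi>"
proof -
  have "degree (d * \<phi> ^ s) \<le> degree d + s * degree \<phi>"
    using degree_mult_le[of d "\<phi> ^ s"] degree_power_eq[OF phi_nz, of s] by simp
  also have "\<dots> < Suc s * degree \<phi>" using assms by simp
  also have "\<dots> \<le> n * degree \<phi>" using assms by (intro mult_le_mono1) simp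
  finally show ?thesis by (simp add: degree_psi)
qed

text \<open>The assumptions reproduce themselves because the multiplicative \<open>T\<close> agrees
  with \<open>W\<close> below \<open>degree \<psi>\<close>. In particular a product of two such
  polynomials shows no gap, so its remainder has its value.\<close>

lemma value_truncation_psi: "value_truncation W \<psi>"
proof unfold_locales
  show "0 < degree \<psi>" by (rule degree_psi_pos)
  show "W a \<noteq> Infty" if "degree a < degree \<psi>" "a \<noteq> 0" for a
    using that T_below[of a] T_eq_Infty_iff[of a] by metis
  show "W (a * b mod \<psi>) = W (a * b)" if "degree a < degree \<psi>" "degree b < degree \<psi>" for a b
  proof -
    have "T (a * b) = W (a * b)" using that by (simp add: T_mult mult T_below)
    then have "T (a * b mod \<psi>) \<le> T (a * b)" using T_less_W[of "a * b"] by force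
    then show ?thesis by (rule mod_psi_le)
  qed
  show "\<exists>b. degree b < degree \<psi> \<and> W (a * b) = 0" if a: "degree a < degree \<psi>" "a \<noteq> 0" for a
  proof -
    obtain d s where d: "degree d < degree \<phi>" "s < n" "W a = W (d * \<phi> ^ s)"
      using T_value[OF a(2)] T_below[OF a(1)] by auto
    have fin: "W a \<noteq> Infty" using a T_below[of a] T_eq_Infty_iff[of a] by metis
    then have "d \<noteq> 0" using d(3) by auto
    then obtain d' where d': "degree d' < degree \<phi>" "W (d * d') = 0" using W_inv d(1) by blast
    show ?thesis
    proof (cases "s = 0")
      case True
      have "degree d' < degree \<psi>"
        using degree_reduced_times_power[OF d'(1), of 0] n_pos by simp
      then show ?thesis using d(3) d'(2) True by (auto simp: mult)
    next
      case False
      \<comment> \<open>The power \<open>\<phi> ^ (n - s)\<close> completes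
        \<open>\<phi> ^ s\<close> to the value of \<open>c\<close>; what remains is cancelled by
        inverse values of \<open>d\<close> and \<open>c\<close>.\<close>
      have "c \<noteq> 0" using W_c W_phi_power_fin[of n] zero by metis
      then obtain c' where c': "degree c' < degree \<phi>" "W (c * c') = 0"
        using W_inv degree_c by blast
      obtain e where e: "degree e < degree \<phi>" "W e = W (d' * c')"
        using reduced_mult[OF d'(1) c'(1)] by blast
      have "W (\<phi> ^ s) + W (\<phi> ^ (n - s)) = W c" using d(2) W_c by (simp flip: mult power_add)
      moreover have "W (a * (e * \<phi> ^ (n - s)))
          = W (d * d') + (W (\<phi> ^ s) + W (\<phi> ^ (n - s))) + W c'"
        using d(3) e(2) by (simp only: mult ac_simps)
      ultimately have "W (a * (e * \<phi> ^ (n - s))) = W (d * d') + W (c * c')"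
        by (simp only: mult add.assoc)
      then have "W (a * (e * \<phi> ^ (n - s))) = 0" using d' c' by simp
      then show ?thesis
        using degree_reduced_times_power[OF e(1), of "n - s"] False n_pos by auto
    qed
  qed
qed

sublocale psi: value_truncation W \<psi>
  by (rule value_truncation_psi)

text \<open>Lowering exponents modulo \<open>n\<close> brings every finite value of \<open>T\<close>
  below \<open>degree \<psi>\<close>, where \<open>T\<close> and \<open>W\<close> agree.\<close>

lemma value_group_T: "value_group T = psi.reduced_values"
proof (rule psi.value_group_eq_reduced_values)
  fix x
  show "(\<exists>g. T g = Fin x) \<longleftrightarrow> x \<in> psi.reduced_values"
  proof
    assume "\<exists>g. T g = Fin x"
    then obtain g where g: "T g = Fin x" ..
    then have "g \<noteq> 0" by auto
    then obtain d s where "degree d < degree \<phi>" "s < n" "T g = W (d * \<phi> ^ s)" using T_value by blast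
    then show "x \<in> psi.reduced_values"
      using g degree_reduced_times_power by (auto simp: psi.reduced_values_def)
  next
    assume "x \<in> psi.reduced_values"
    then obtain a where "degree a < degree \<psi>" "W a = Fin x"
      by (auto simp: psi.reduced_values_def)
    then show "\<exists>g. T g = Fin x" using T_below[of a] by auto
  qed
qed

text \<open>The values of \<open>\<phi> ^ s\<close> with \<open>s < n\<close> represent the cosets:
  minimality of \<open>n\<close> keeps them apart, and \<open>T_value\<close> shows that there are
  no others.\<close>

lemma has_index_reduced_values: "has_index psi.reduced_values reduced_values n"
proof -
  \<comment> \<open>The default \<open>0\<close> is never taken, as powers of \<open>\<phi>\<close>
    have finite value.\<close>
  define \<mu> where "\<mu> s = (case W (\<phi> ^ s) of Fin x \<Rightarrow> x | Infty \<Rightarrow> 0)" for s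
  have \<mu>: "W (\<phi> ^ s) = Fin (\<mu> s)" for s
    using W_phi_power_fin[of s] unfolding \<mu>_def by (cases "W (\<phi> ^ s)") auto
  let ?C = "\<lambda>g. (+) g ` reduced_values"
  have coset: "?C (x + y) = ?C y" if x: "x \<in> reduced_values" for x y
  proof
    show "?C (x + y) \<subseteq> ?C y"
    proof
      fix z assume "z \<in> ?C (x + y)"
      then obtain w where "w \<in> reduced_values" "z = x + y + w" by auto
      then show "z \<in> ?C y"
        using reduced_values_add[OF x, of w] by (intro image_eqI[of _ _ "x + w"]) (auto simp: ac_simps)
    qed
    show "?C y \<subseteq> ?C (x + y)"
    proof
      fix z assume "z \<in> ?C y"
      then obtain w where "w \<in> reduced_values" "z = y + w" by auto
      then show "z \<in> ?C (x + y)"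
        using reduced_values_diff[OF _ x, of w] by (intro image_eqI[of _ _ "w - x"]) auto
    qed
  qed
  have "bij_betw (\<lambda>s. ?C (\<mu> s)) {..<n} (?C ` psi.reduced_values)"
  proof (rule bij_betw_imageI)
    have False if "s < t" "t < n" and eq: "?C (\<mu> s) = ?C (\<mu> t)" for s t
    proof -
      have "\<mu> s + 0 \<in> ?C (\<mu> t)" using reduced_values_0 unfolding eq[symmetric] by blast
      then obtain w where w: "w \<in> reduced_values" "\<mu> s = \<mu> t + w" by auto
      then obtain b where b: "degree b < degree \<phi>" "W b = Fin w"
        by (auto simp: reduced_values_def)
      then have "W (1 * \<phi> ^ s) = W (b * \<phi> ^ t)" by (simp add: mult \<mu> w(2) add.commute)
      moreover have "b \<noteq> 0" using b by auto
      ultimately obtain d where "degree d < degree \<phi>" "W d = W (\<phi> ^ (t - s))"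
        using value_ratio[of 1 b s t] b degree_pos \<open>s < t\<close> by auto
      then show False using n_minimal[of "t - s" d] that by simp
    qed
    then show "inj_on (\<lambda>s. ?C (\<mu> s)) {..<n}"
      by (intro inj_onI) (metis lessThan_iff linorder_neqE_nat)
    show "(\<lambda>s. ?C (\<mu> s)) ` {..<n} = ?C ` psi.reduced_values"
    proof safe
      fix s assume "s < n"
      then have "\<mu> s \<in> psi.reduced_values"
        using degree_reduced_times_power[of 1 s] \<mu>[of s] degree_pos
        by (auto simp: psi.reduced_values_def intro!: exI[of _ "\<phi> ^ s"])
      then show "?C (\<mu> s) \<in> ?C ` psi.reduced_values" by blast
    next
      fix x assume "x \<in> psi.reduced_values"
      then obtain a where a: "degree a < degree \<psi>" "W a = Fin x"
        by (auto simp: psi.reduced_values_def)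
      then have "a \<noteq> 0" by auto
      then obtain d s where d: "degree d < degree \<phi>" "s < n" "W a = W (d * \<phi> ^ s)"
        using T_value T_below[OF a(1)] by metis
      then obtain w where w: "W d = Fin w" "x = w + \<mu> s"
        using a(2) \<mu> by (cases "W d") (auto simp: mult)
      then have "w \<in> reduced_values" using d(1) by (auto simp: reduced_values_def)
      then have "?C x = ?C (\<mu> s)" unfolding w(2) by (rule coset)
      then show "?C x \<in> (\<lambda>s. ?C (\<mu> s)) ` {..<n}" using d(2) by blast
    qed
  qed
  then show ?thesis unfolding has_index_def
    by (metis bij_betw_finite bij_betw_same_card card_lessThan finite_lessThan)
qed

end

subsection \<open>Algebraically closed residue fields\<close>

lemma valuation_pseudo_val: "valuation V0 \<Longrightarrow> pseudo_val V0"
proof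
  assume V0: "valuation V0"
  then have "V0 1 + V0 1 = V0 1" unfolding valuation_def by (metis mult_1)
  moreover have "V0 1 \<noteq> Infty" using V0 by (simp add: valuation_def)
  ultimately show "V0 1 = 0" by (cases "V0 1") (auto simp: zero_vext_def)
qed (simp_all add: valuation_def)

text \<open>This transfers algebraic closedness of the subset \<open>F\<close>, expressed with
  coefficient lists, to the polynomial type.\<close>

lemma algebraically_closed_root:
  fixes F :: "'a::field set" and Q :: "'a poly"
  assumes "algebraically_closed (ring_of_type_algebra\<lparr>carrier := F\<rparr>)"
    and "\<And>i. coeff Q i \<in> F" and "0 < degree Q"
  shows "\<exists>x\<in>F. poly Q x = 0"
proof -
  define L where "L = (ring_of_type_algebra :: 'a ring)\<lparr>carrier := F\<rparr>"
  interpret algebraically_closed L using assms(1) by (simp add: L_def)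
  have L [simp]: "carrier L = F" "x \<otimes>\<^bsub>L\<^esub> y = x * y" "x \<oplus>\<^bsub>L\<^esub> y = x + y"
    "\<zero>\<^bsub>L\<^esub> = 0" "\<one>\<^bsub>L\<^esub> = 1" for x y
    by (simp_all add: L_def ring_of_type_algebra_def)
  have pow: "x [^]\<^bsub>L\<^esub> m = x ^ m" for x and m :: nat
    by (induction m) (simp_all add: mult.commute)
  \<comment> \<open>The lists start with the leading coefficient, hence the reversal.\<close>
  define P where "P = rev (coeffs Q)"
  have deg: "Polynomials.degree P = Polynomial.degree Q"
    by (auto simp: P_def degree_eq_length_coeffs)
  have "set P \<subseteq> F" using assms(2) by (auto simp: P_def coeffs_def)
  then have carrier_P: "P \<in> carrier (poly_ring L)"
    by (auto simp: univ_poly_def polynomial_def P_def hd_rev last_coeffs_eq_coeff_degree)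
  then have "splitted P" by (rule roots_over_carrier)
  then have "roots P \<noteq> {#}" unfolding splitted_def using deg assms(3) by auto
  then obtain x where "x \<in># roots P" by blast
  then have x: "is_root P x" using roots_mem_iff_is_root[OF carrier_P] by auto
  have "eval xs x = poly (Poly (rev xs)) x" for xs
    by (induction xs) (auto simp: Poly_append poly_monom pow)
  from this[of P] have "poly Q x = 0" using x by (simp add: P_def is_root_def)
  then show ?thesis using x by (auto simp: is_root_def)
qed

locale residue_valuation = pseudo_val V0
  for V0 :: "'a::field \<Rightarrow> 'g::linordered_ab_group_add vext" +
  fixes F :: "'a set"
  assumes alg_closed: "algebraically_closed (ring_of_type_algebra\<lparr>carrier := F\<rparr>)"
    and residue_iso: "(ring_of_type_algebra \<lparr>carrier := valuation_ring V0\<rparr>) Quot (valuation_ideal V0)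
               \<simeq> ring_of_type_algebra \<lparr>carrier := F\<rparr>"
begin

text \<open>The isomorphism from the residue ring to \<open>F\<close> is turned into a plain
  function on the field, of which nothing is claimed outside the valuation ring.\<close>

lemma residue_map:
  obtains \<rho> :: "'a \<Rightarrow> 'a" where
    "\<And>u. 0 \<le> V0 u \<Longrightarrow> \<rho> u \<in> F"
    "\<And>x. x \<in> F \<Longrightarrow> \<exists>u. 0 \<le> V0 u \<and> \<rho> u = x"
    "\<And>u v. 0 \<le> V0 u \<Longrightarrow> 0 \<le> V0 v \<Longrightarrow> \<rho> (u + v) = \<rho> u + \<rho> v"
    "\<And>u v. 0 \<le> V0 u \<Longrightarrow> 0 \<le> V0 v \<Longrightarrow> \<rho> (u * v) = \<rho> u * \<rho> v"
    "\<And>u. 0 \<le> V0 u \<Longrightarrow> \<rho> u = 0 \<longleftrightarrow> 0 < V0 u"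
proof -
  define A where "A = (ring_of_type_algebra :: 'a ring)\<lparr>carrier := valuation_ring V0\<rparr>"
  define L where "L = (ring_of_type_algebra :: 'a ring)\<lparr>carrier := F\<rparr>"
  define I where "I = valuation_ideal V0"
  have A [simp]: "carrier A = {u. 0 \<le> V0 u}" "x \<otimes>\<^bsub>A\<^esub> y = x * y" "x \<oplus>\<^bsub>A\<^esub> y = x + y"
    "\<zero>\<^bsub>A\<^esub> = 0" "\<one>\<^bsub>A\<^esub> = 1" for x y
    by (simp_all add: A_def ring_of_type_algebra_def valuation_ring_def)
  have L [simp]: "carrier L = F" "x \<otimes>\<^bsub>L\<^esub> y = x * y" "x \<oplus>\<^bsub>L\<^esub> y = x + y"
    "\<zero>\<^bsub>L\<^esub> = 0" "\<one>\<^bsub>L\<^esub> = 1" for x y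
    by (simp_all add: L_def ring_of_type_algebra_def)
  have prod_nonneg: "0 \<le> V0 (a * b)" if "0 \<le> V0 a" "0 \<le> V0 b" for a b
    using add_mono[OF that] by (simp add: mult)
  have "ring A" unfolding A_def
  proof (rule ring.subring_is_ring[OF ring_from_type_algebra], rule ring.subringI[OF ring_from_type_algebra])
    have minus: "\<ominus>\<^bsub>ring_of_type_algebra\<^esub> a = - a" for a :: 'a
    proof -
      interpret R: ring "ring_of_type_algebra :: 'a ring" by auto
      show ?thesis by (rule R.minus_equality) (auto simp: ring_of_type_algebra_def)
    qed
    show "\<ominus>\<^bsub>ring_of_type_algebra\<^esub> h \<in> valuation_ring V0" if "h \<in> valuation_ring V0" for h
      using that by (simp add: minus valuation_ring_def)
  qed (auto simp: ring_of_type_algebra_def valuation_ring_def intro: prod_nonneg ge_addI)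
  then interpret A: ring A .
  have "ideal I A"
  proof (rule idealI)
    show "subgroup I (add_monoid A)"
    proof
      fix a assume a: "a \<in> I"
      then have a': "0 \<le> V0 a" by (simp add: I_def valuation_ideal_def order_less_imp_le)
      have "\<ominus>\<^bsub>A\<^esub> a = - a" using a' by (intro A.minus_equality) auto
      then show "inv\<^bsub>add_monoid A\<^esub> a \<in> I" using a by (simp add: a_inv_def I_def valuation_ideal_def)
    qed (auto simp: I_def valuation_ideal_def intro: gt_addI)
    show "x \<otimes>\<^bsub>A\<^esub> a \<in> I" "a \<otimes>\<^bsub>A\<^esub> x \<in> I" if "a \<in> I" "x \<in> carrier A" for a x
    proof -
      have "0 + 0 < V0 x + V0 a" using that
        by (intro vext_add_le_less_mono) (auto simp: I_def valuation_ideal_def)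
      then show "x \<otimes>\<^bsub>A\<^esub> a \<in> I" "a \<otimes>\<^bsub>A\<^esub> x \<in> I"
        by (simp_all add: I_def valuation_ideal_def mult add.commute)
    qed
  qed (rule A.ring_axioms)
  then interpret I: ideal I A .
  obtain h where h: "h \<in> ring_iso (A Quot I) L"
    using residue_iso by (auto simp: is_ring_iso_def A_def I_def L_def)
  note h = ring_iso_memE[OF h]
  define \<rho> where "\<rho> u = h (I +>\<^bsub>A\<^esub> u)" for u
  note q = ring_hom_memE[OF I.rcos_ring_hom]
  have zero_eq: "\<rho> u = 0 \<longleftrightarrow> 0 < V0 u" if u: "0 \<le> V0 u" for u
  proof -
    have car: "I +>\<^bsub>A\<^esub> u \<in> carrier (A Quot I)" "I +>\<^bsub>A\<^esub> 0 \<in> carrier (A Quot I)" using u q(1) by auto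
    have "\<rho> 0 + \<rho> 0 = \<rho> 0"
      using h(3)[OF car(2,2)] q(3)[of 0 0] by (simp add: \<rho>_def)
    then have "\<rho> 0 = 0" by (simp only: add_cancel_left_left)
    then have "\<rho> u = 0 \<longleftrightarrow> I +>\<^bsub>A\<^esub> u = I +>\<^bsub>A\<^esub> 0"
      using h(5) car unfolding \<rho>_def bij_betw_def by (metis inj_on_contraD)
    also have "I +>\<^bsub>A\<^esub> 0 = I"
      by (rule A.a_rcos_zero[OF I.ideal_axioms]) (simp add: I_def valuation_ideal_def)
    also have "I +>\<^bsub>A\<^esub> u = I \<longleftrightarrow> u \<in> I"
      using u I.rcos_const_imp_mem A.a_rcos_zero[OF I.ideal_axioms] by auto
    finally show ?thesis by (simp add: I_def valuation_ideal_def)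
  qed
  show ?thesis
  proof (rule that[of \<rho>])
    show "\<exists>u. 0 \<le> V0 u \<and> \<rho> u = x" if "x \<in> F" for x
    proof -
      have "x \<in> h ` carrier (A Quot I)" using h(5) that by (simp add: bij_betw_def)
      then obtain C where C: "C \<in> carrier (A Quot I)" "x = h C" by blast
      then obtain u where "u \<in> carrier A" "C = I +>\<^bsub>A\<^esub> u"
        by (auto simp: FactRing_def A_RCOSETS_def')
      then show ?thesis using C(2) by (auto simp: \<rho>_def)
    qed
    show "\<rho> u \<in> F" if "0 \<le> V0 u" for u using h(1) q(1) that by (simp add: \<rho>_def)
    show "\<rho> (u + v) = \<rho> u + \<rho> v" "\<rho> (u * v) = \<rho> u * \<rho> v" if "0 \<le> V0 u" "0 \<le> V0 v" for u v
      using h(2,3)[OF q(1) q(1), of u v] q(2,3)[of u v] that by (simp_all add: \<rho>_def)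
  qed (rule zero_eq)
qed

text \<open>Reduce the coefficients, take a root in \<open>F\<close> and lift it.\<close>

lemma residue_root:
  assumes P: "\<And>i. 0 \<le> V0 (coeff P i)" and lead: "V0 (lead_coeff P) = 0" and deg: "0 < degree P"
  shows "\<exists>u. 0 \<le> V0 u \<and> 0 < V0 (poly P u)"
proof -
  obtain \<rho> :: "'a \<Rightarrow> 'a" where \<rho>:
    "\<And>u. 0 \<le> V0 u \<Longrightarrow> \<rho> u \<in> F"
    "\<And>x. x \<in> F \<Longrightarrow> \<exists>u. 0 \<le> V0 u \<and> \<rho> u = x"
    "\<And>u v. 0 \<le> V0 u \<Longrightarrow> 0 \<le> V0 v \<Longrightarrow> \<rho> (u + v) = \<rho> u + \<rho> v"
    "\<And>u v. 0 \<le> V0 u \<Longrightarrow> 0 \<le> V0 v \<Longrightarrow> \<rho> (u * v) = \<rho> u * \<rho> v"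
    "\<And>u. 0 \<le> V0 u \<Longrightarrow> \<rho> u = 0 \<longleftrightarrow> 0 < V0 u" by (rule residue_map, rule that)
  have \<rho>0: "\<rho> 0 = 0" using \<rho>(5)[of 0] by simp
  define Q where "Q = map_poly \<rho> P"
  have coeff_Q: "coeff Q i = \<rho> (coeff P i)" for i by (simp add: Q_def coeff_map_poly \<rho>0)
  \<comment> \<open>A unit leading coefficient survives the reduction, so \<open>Q\<close> is not
    constant.\<close>
  have "coeff Q (degree P) \<noteq> 0" using \<rho>(5)[OF P, of "degree P"] lead by (simp add: coeff_Q)
  then have deg_Q: "degree Q = degree P"
    by (intro antisym le_degree degree_le) (simp_all add: coeff_Q coeff_eq_0 \<rho>0)
  then obtain x where x: "x \<in> F" "poly Q x = 0"
    using algebraically_closed_root[OF alg_closed, of Q] deg by (auto simp: coeff_Q \<rho>(1) P)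
  obtain u where u: "0 \<le> V0 u" "\<rho> u = x" using \<rho>(2) x(1) by blast
  have prod_nonneg: "0 \<le> V0 (a * b)" if "0 \<le> V0 a" "0 \<le> V0 b" for a b
    using add_mono[OF that] by (simp add: mult)
  have pow: "0 \<le> V0 (u ^ i)" "\<rho> (u ^ i) * x = \<rho> (u ^ Suc i)" for i
  proof -
    show *: "0 \<le> V0 (u ^ i)" by (induction i) (auto intro: prod_nonneg u(1))
    show "\<rho> (u ^ i) * x = \<rho> (u ^ Suc i)" using \<rho>(4)[OF * u(1)] u(2) by (simp add: mult.commute)
  qed
  have "\<rho> 1 = 1"
  proof -
    have "\<rho> 1 * \<rho> 1 = \<rho> 1" "\<rho> 1 \<noteq> 0" using \<rho>(4)[of 1 1] \<rho>(5)[of 1] by simp_all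
    then show ?thesis by simp
  qed
  have pow_eq: "\<rho> (u ^ i) = x ^ i" for i
  proof (induction i)
    case (Suc i)
    then show ?case using pow(2)[of i] by (simp add: mult.commute)
  qed (simp add: \<open>\<rho> 1 = 1\<close>)
  have sum_eq: "0 \<le> V0 (sum t S) \<and> \<rho> (sum t S) = (\<Sum>i\<in>S. \<rho> (t i))"
    if "\<And>i. 0 \<le> V0 (t i)" for S :: "nat set" and t
    using that by (induction S rule: infinite_finite_induct) (auto simp: \<rho> \<rho>0 intro: ge_addI)
  have nonneg: "0 \<le> V0 (coeff P i * u ^ i)" for i using P pow(1) by (rule prod_nonneg)
  have "\<rho> (poly P u) = (\<Sum>i\<le>degree P. \<rho> (coeff P i * u ^ i))"
    unfolding poly_altdef using sum_eq[of "\<lambda>i. coeff P i * u ^ i"] nonneg by blast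
  also have "\<dots> = poly Q x" unfolding poly_altdef deg_Q coeff_Q by (simp add: \<rho>(4) P pow pow_eq)
  finally have "\<rho> (poly P u) = 0" using x(2) by simp
  moreover have "0 \<le> V0 (poly P u)" unfolding poly_altdef using sum_eq[of "\<lambda>i. coeff P i * u ^ i"] nonneg by blast
  ultimately show ?thesis using \<rho>(5) u(1) by blast
qed

end

section \<open>Arithmetic modulo an irreducible polynomial\<close>

lemma inverse_mod_irreducible:
  fixes f h :: "'a::field poly"
  assumes "irreducible f" "h \<noteq> 0" "degree h < degree f"
  shows "\<exists>a. f dvd a * h - 1"
  using assms(2,3)
proof (induction "degree h" arbitrary: h rule: less_induct)
  case less
  show ?case
  proof (cases "degree h = 0")
    case True
    then obtain c where "h = [:c:]" by (metis degree_eq_zeroE)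
    then show ?thesis using less.prems by (intro exI[of _ "[:inverse c:]"]) (simp add: one_pCons)
  next
    case False
    \<comment> \<open>A Euclidean step: an inverse of the remainder \<open>r\<close>, multiplied by
      \<open>- q\<close>, inverts \<open>h\<close> modulo \<open>f\<close>.\<close>
    define q r where "q = f div h" and "r = f mod h"
    have f: "f = h * q + r" unfolding q_def r_def by simp
    have "r \<noteq> 0"
    proof
      assume "r = 0"
      then have "h dvd 1 \<or> q dvd 1" using irreducibleD[OF assms(1), of h q] f by simp
      moreover have "\<not> h dvd 1" using False by (auto simp: is_unit_iff_degree less.prems)
      moreover have "q \<noteq> 0" using f \<open>r = 0\<close> less.prems by auto
      ultimately have "degree q = 0" by (simp add: is_unit_iff_degree)
      then have "degree f = degree h" using f \<open>r = 0\<close> \<open>q \<noteq> 0\<close> less.prems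
        by (simp add: degree_mult_eq)
      then show False using less.prems by simp
    qed
    moreover have dr: "degree r < degree h"
      using False less.prems(1) degree_mod_less'[of h f] \<open>r \<noteq> 0\<close> by (simp add: r_def)
    ultimately obtain a where "f dvd a * r - 1" using less.hyps[of r] less.prems by auto
    moreover have "a * r - 1 = f * a + ((- a * q) * h - 1)"
      by (subst f) (simp add: algebra_simps)
    ultimately have "f dvd (- a * q) * h - 1" by (simp only: dvd_add_right_iff dvd_triv_left)
    then show ?thesis by blast
  qed
qed

lemma pcompose_monom: "pcompose (monom a n) x = smult a (x ^ n)"
  by (induction n) (simp_all add: monom_0 monom_Suc pcompose_pCons)

text \<open>The powers of \<open>x\<close> with exponents up to \<open>degree f\<close> lie, modulo
  \<open>f\<close>, in a space spanned by \<open>degree f\<close> monomials, so they satisfy a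
  linear relation.\<close>

lemma algebraic_mod:
  fixes f x :: "'a::field poly"
  assumes "0 < degree f"
  shows "\<exists>P. P \<noteq> 0 \<and> f dvd pcompose P x"
proof -
  interpret vs: vector_space "smult :: 'a \<Rightarrow> 'a poly \<Rightarrow> 'a poly"
    by unfold_locales (auto simp: smult_add_left smult_add_right)
  define v where "v i = x ^ i mod f" for i
  have v: "f dvd x ^ i - v i" for i by (simp add: v_def minus_mod_eq_mult_div)
  have relation: ?thesis if "finite I" "\<exists>i\<in>I. p i \<noteq> 0" "(\<Sum>i\<in>I. smult (p i) (v i)) = 0" for p and I :: "nat set"
  proof -
    define P where "P = (\<Sum>i\<in>I. monom (p i) i)"
    have coeff: "coeff P i = (if i \<in> I then p i else 0)" for i
      using that(1) by (simp add: P_def coeff_sum)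
    have "pcompose P x = (\<Sum>i\<in>I. smult (p i) (x ^ i))"
      unfolding P_def by (simp add: pcompose_sum pcompose_monom)
    also have "\<dots> = (\<Sum>i\<in>I. smult (p i) (x ^ i - v i))"
      using that(3) by (simp add: smult_diff_right sum_subtractf)
    finally have "f dvd pcompose P x" using v by (auto intro!: dvd_sum dvd_smult)
    moreover have "P \<noteq> 0" using that(2) coeff by (metis coeff_0)
    ultimately show ?thesis by blast
  qed
  show ?thesis
  \<comment> \<open>Linear dependence is a property of sets, so powers that coincide modulo
    \<open>f\<close> are treated apart.\<close>
  proof (cases "inj_on v {..degree f}")
    case False
    then obtain i l where il: "i \<noteq> l" "v i = v l" by (auto simp: inj_on_def)
    show ?thesis
      by (rule relation[of "{i, l}" "\<lambda>m. if m = i then 1 else - 1"]) (use il in auto)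
  next
    case True
    have "v ` {..degree f} \<subseteq> vs.span (monom 1 ` {..<degree f})"
    proof safe
      fix i
      have "degree (v i) < degree f" unfolding v_def
        using assms degree_mod_less'[of f "x ^ i"] by (cases "x ^ i mod f = 0"; cases "f = 0") auto
      then have "v i = (\<Sum>m<degree f. smult (coeff (v i) m) (monom 1 m))"
        by (intro poly_eqI) (auto simp: coeff_sum coeff_eq_0 if_distrib cong: if_cong)
      also have "\<dots> \<in> vs.span (monom 1 ` {..<degree f})"
        by (intro vs.span_sum vs.span_scale vs.span_base) auto
      finally show "v i \<in> vs.span (monom 1 ` {..<degree f})" .
    qed
    moreover have "card (monom (1::'a) ` {..<degree f}) < card (v ` {..degree f})"
      using card_image_le[of "{..<degree f}" "monom (1::'a)"] card_image[OF True] by simp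
    ultimately have "vs.dependent (v ` {..degree f})"
      using vs.independent_span_bound[of "monom 1 ` {..<degree f}" "v ` {..degree f}"] by auto
    then obtain p where p: "\<exists>w\<in>v ` {..degree f}. p w \<noteq> 0" "(\<Sum>w\<in>v ` {..degree f}. smult (p w) w) = 0"
      using vs.dependent_finite[of "v ` {..degree f}"] by auto
    show ?thesis
      by (rule relation[of "{..degree f}" "p \<circ> v"]) (use p in \<open>auto simp: sum.reindex[OF True]\<close>)
  qed
qed

section \<open>The residue field does not grow from \<open>V0\<close> to \<open>W\<close>\<close>

locale residue_extension = residue_valuation V0 F + W: pseudo_val W
  for V0 :: "'a::field \<Rightarrow> 'g::linordered_ab_group_add vext" and F :: "'a set"
    and W :: "'a poly \<Rightarrow> 'g vext" +
  fixes f :: "'a poly"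
  assumes V0_eq_Infty: "V0 a = Infty \<Longrightarrow> a = 0"
    and W_const: "W [:a:] = V0 a"
    and f_irreducible: "irreducible f"
    and W_eq_Infty_iff: "W g = Infty \<longleftrightarrow> f dvd g"
begin

lemma degree_f_pos: "0 < degree f"
  using f_irreducible by (auto simp: irreducible_def is_unit_iff_degree)

lemma W_smult: "W (smult a g) = V0 a + W g"
  using W.mult[of "[:a:]" g] by (simp add: W_const)

text \<open>Induction on the degree: split off the factor \<open>z - u\<close> for a root
  \<open>u\<close> of the reduction of \<open>P\<close>. Then either \<open>x\<close> is congruent
  to \<open>u\<close>, or the cofactor still takes a positive value at \<open>x\<close>.\<close>

lemma residue_class_of_root:
  assumes "0 \<le> W x"
  shows "(\<And>i. 0 \<le> V0 (coeff P i)) \<Longrightarrow> \<exists>i. V0 (coeff P i) = 0 \<Longrightarrow> 0 < W (pcompose P x)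
    \<Longrightarrow> \<exists>u. 0 \<le> V0 u \<and> 0 < W (x - [:u:])"
proof (induction "degree P" arbitrary: P rule: less_induct)
  case less
  define n where "n = degree P"
  obtain m where m: "V0 (coeff P m) = 0" using less.prems(2) by blast
  then have "coeff P m \<noteq> 0" by auto
  then have "m \<le> n" by (simp add: n_def le_degree)
  have xpow: "0 \<le> W (x ^ i)" for i
    by (induction i) (use add_mono[OF assms] in \<open>auto simp: W.mult\<close>)
  show ?case
  proof (cases "V0 (lead_coeff P) = 0")
    case False
    then have lead: "0 < V0 (lead_coeff P)" "m \<noteq> n"
      using less.prems(1)[of "degree P"] m by (auto simp: n_def order_le_less)
    define P' where "P' = P - monom (lead_coeff P) n"
    have coeff: "coeff P' i = (if i = n then 0 else coeff P i)" for i
      by (auto simp: P'_def n_def)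
    have "degree P' < degree P"
    proof -
      have "degree P' \<le> n - 1"
        by (rule degree_le) (auto simp: coeff n_def coeff_eq_0)
      then show ?thesis using lead(2) \<open>m \<le> n\<close> by (simp add: n_def)
    qed
    moreover have "0 < W (pcompose P' x)"
    proof -
      have "0 + 0 < W (x ^ n) + V0 (lead_coeff P)"
        using lead(1) xpow by (intro vext_add_le_less_mono) auto
      then have "0 < W (smult (lead_coeff P) (x ^ n))" by (simp add: W_smult add.commute)
      then show ?thesis unfolding P'_def pcompose_diff pcompose_monom
        by (intro W.gt_diffI less.prems(3))
    qed
    moreover have "V0 (coeff P' m) = 0" using m lead(2) by (simp add: coeff)
    moreover have "0 \<le> V0 (coeff P' i)" for i using less.prems(1) by (simp add: coeff)
    ultimately show ?thesis using less.hyps[of P'] by blast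
  next
    case True
    have "n \<noteq> 0"
    proof
      assume "n = 0"
      then obtain a where "P = [:a:]" by (metis n_def degree_eq_zeroE)
      then show False using True less.prems(3) by (simp add: W_const)
    qed
    then obtain u where u: "0 \<le> V0 u" "0 < V0 (poly P u)"
      using residue_root[of P] less.prems(1) True by (auto simp: n_def)
    define Q where "Q = synthetic_div P u"
    have P: "P = [:- u, 1:] * Q + [:poly P u:]" unfolding Q_def by (rule synthetic_div_correct'[symmetric])
    have deg_Q: "degree Q = n - 1" by (simp add: Q_def n_def degree_synthetic_div)
    have coeff_Q: "coeff Q i = coeff P (Suc i) + u * coeff Q (Suc i)" for i
      by (subst P) simp
    \<comment> \<open>The recursion for the coefficients runs down from the top, hence the induction
      on \<open>n - i\<close>.\<close>
    have nonneg_Q: "0 \<le> V0 (coeff Q i)" for i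
    proof (induction "n - i" arbitrary: i)
      case 0
      then have "coeff Q i = 0" using deg_Q \<open>n \<noteq> 0\<close> by (intro coeff_eq_0) simp
      then show ?case by simp
    next
      case (Suc j)
      then have "0 \<le> V0 (coeff Q (Suc i))" by simp
      then have "0 \<le> V0 (u * coeff Q (Suc i))" using add_mono[OF u(1)] by (fastforce simp: mult)
      then show ?case unfolding coeff_Q[of i] by (intro ge_addI less.prems(1))
    qed
    have "coeff Q (n - 1) = lead_coeff P"
      using coeff_Q[of "n - 1"] \<open>n \<noteq> 0\<close> deg_Q by (simp add: n_def coeff_eq_0)
    then have unit_Q: "\<exists>i. V0 (coeff Q i) = 0" using True by metis
    have "pcompose P x = (x - [:u:]) * pcompose Q x + [:poly P u:]"
    proof -
      have "[:- u:] + x = x - [:u:]" by simp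
      then show ?thesis by (subst P) (simp add: pcompose_add pcompose_diff pcompose_mult pcompose_smult pcompose_pCons algebra_simps)
    qed
    then have "(x - [:u:]) * pcompose Q x = pcompose P x - [:poly P u:]" by simp
    then have prod: "0 < W (x - [:u:]) + W (pcompose Q x)"
      using less.prems(3) u(2) W.gt_diffI[of 0 "pcompose P x" "[:poly P u:]"]
      by (simp add: W_const flip: W.mult)
    show ?thesis
    proof (cases "0 < W (x - [:u:])")
      case False
      moreover have "0 \<le> W (x - [:u:])" using assms u by (intro W.ge_diffI) (auto simp: W_const)
      ultimately have "W (x - [:u:]) = 0" by simp
      then have "0 < W (pcompose Q x)" using prod by simp
      then show ?thesis using less.hyps[of Q] nonneg_Q unit_Q deg_Q \<open>n \<noteq> 0\<close> by (simp add: n_def)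
    qed (use u in blast)
  qed
qed

text \<open>Modulo \<open>f\<close> the element \<open>x\<close> is a root of some
  \<open>P \<noteq> 0\<close>. Dividing \<open>P\<close> by a coefficient of least value makes its
  coefficients integral and one of them a unit.\<close>

lemma residue_class_exists:
  assumes "0 \<le> W x"
  shows "\<exists>u. 0 \<le> V0 u \<and> 0 < W (x - [:u:])"
proof -
  obtain P where P: "P \<noteq> 0" "f dvd pcompose P x" using algebraic_mod[OF degree_f_pos] by blast
  obtain m where m: "m \<in> {..degree P}" "\<And>i. i \<in> {..degree P} \<Longrightarrow> V0 (coeff P m) \<le> V0 (coeff P i)"
    using ex_min_if_finite[of "(\<lambda>i. V0 (coeff P i)) ` {..degree P}"] by (fastforce simp: not_less)
  have m_le: "V0 (coeff P m) \<le> V0 (coeff P i)" for i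
    using m(2)[of i] by (cases "i \<le> degree P") (auto simp: coeff_eq_0)
  have nz: "coeff P m \<noteq> 0" using m_le[of "degree P"] P(1) V0_eq_Infty by (metis leading_coeff_0_iff vext_Infty_le_iff zero)
  define a where "a = inverse (coeff P m)"
  have a: "V0 (coeff P m) + V0 a = 0" using nz by (simp add: a_def flip: mult)
  show ?thesis
  proof (rule residue_class_of_root[OF assms, of "smult a P"])
    show "0 \<le> V0 (coeff (smult a P) i)" for i
      using add_left_mono[OF m_le, of "V0 a" i] a by (simp add: mult add.commute)
    show "\<exists>i. V0 (coeff (smult a P) i) = 0"
      using a by (intro exI[of _ m]) (simp add: mult add.commute)
    have "W (pcompose (smult a P) x) = Infty"
      using P(2) W_eq_Infty_iff by (simp add: pcompose_smult W_smult)
    then show "0 < W (pcompose (smult a P) x)" by simp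
  qed
qed

text \<open>The constant \<open>u\<close> lifts the residue class of \<open>g / h\<close>, where an
  inverse modulo \<open>f\<close> replaces division by \<open>h\<close>.\<close>

lemma equal_values_unit:
  assumes "W g = W h" "W h \<noteq> Infty"
  shows "\<exists>u. V0 u = 0 \<and> W h < W (g - smult u h)"
proof -
  have nd: "\<not> f dvd h" using assms W_eq_Infty_iff by simp
  have "f \<noteq> 0" using degree_f_pos by auto
  have "h mod f \<noteq> 0" using nd by (simp add: mod_eq_0_iff_dvd)
  moreover have "degree (h mod f) < degree f" using degree_mod_less'[OF \<open>f \<noteq> 0\<close> \<open>h mod f \<noteq> 0\<close>] .
  ultimately obtain a where a: "f dvd a * (h mod f) - 1"
    using inverse_mod_irreducible[OF f_irreducible] by blast
  have "a * h - 1 = a * (h mod f) - 1 + f * (a * (h div f))"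
    by (metis (no_types, opaque_lifting) add.commute diff_add_eq distrib_left mult.left_commute mult_div_mod_eq)
  then have inv: "f dvd a * h - 1" using a by (simp only: dvd_add_left_iff dvd_triv_left)
  then have "W (a * h - 1) = Infty" using W_eq_Infty_iff by simp
  then have ah: "W a + W h = 0" using W.add_eq[of 1 "a * h - 1"] by (simp add: W.mult)
  define x where "x = g * a"
  have Wx: "W x = 0" using ah assms by (simp add: x_def W.mult add.commute)
  then obtain u where u: "0 \<le> V0 u" "0 < W (x - [:u:])" using residue_class_exists[of x] by auto
  have "V0 u = 0"
  proof (rule ccontr)
    assume "V0 u \<noteq> 0"
    then have "0 < W (x - [:u:] + [:u:])" using u by (intro W.gt_addI) (auto simp: W_const)
    then show False using Wx by simp
  qed
  moreover have "W h < W (g - smult u h)"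
  proof -
    \<comment> \<open>The error of the inverse, \<open>g * (a * h - 1)\<close>, has infinite
      value.\<close>
    have eq: "g - smult u h = h * (x - [:u:]) - g * (a * h - 1)"
      by (simp add: x_def algebra_simps)
    have "W h + 0 < W h + W (x - [:u:])" using u(2) assms vext_add_left_less_iff[of "W h" 0] by blast
    moreover have "W (g * (a * h - 1)) = Infty" using inv W_eq_Infty_iff by simp
    ultimately show ?thesis unfolding eq using assms by (intro W.gt_diffI) (simp_all add: W.mult)
  qed
  ultimately show ?thesis by blast
qed

end

subsection \<open>The sequence of key polynomials\<close>

lemma adic_coeff_linear: "adic_coeff [:0, 1:] g i = [:coeff g i:]"
proof (induction i arbitrary: g)
  case 0
  obtain a h where "g = pCons a h" by (cases g)
  then have g: "g = [:a:] + h * [:0, 1:]" by simp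
  have "adic_coeff [:0, 1:] g 0 = [:a:]"
    unfolding g adic_coeff_add adic_coeff_mult_0 by (simp add: adic_coeff_reduced)
  then show ?case using \<open>g = pCons a h\<close> by simp
next
  case (Suc i)
  obtain a h where "g = pCons a h" by (cases g)
  then have g: "g = [:a:] + h * [:0, 1:]" by simp
  have nz: "[:0, 1:] \<noteq> (0 :: 'a poly)" by simp
  have "adic_coeff [:0, 1:] g (Suc i) = adic_coeff [:0, 1:] h i"
    unfolding g adic_coeff_add adic_coeff_mult_Suc[OF nz] by (simp add: adic_coeff_reduced)
  then show ?case using \<open>g = pCons a h\<close> by (simp add: Suc)
qed

text \<open>The first stage thereby becomes a truncation at \<open>z\<close> and needs no separate
  treatment.\<close>

lemma first_stage_eq_augment:
  assumes "\<And>a. W [:a:] = V0 a"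
  shows "first_stage V0 \<mu> = augment W [:0, 1:] \<mu>"
  by (rule ext) (simp add: first_stage_def augment_def adic_coeff_linear assms)

lemma augment_cong:
  assumes "0 < degree \<phi>" "\<And>g. degree g < degree \<phi> \<Longrightarrow> V g = V' g"
  shows "augment V \<phi> \<mu> = augment V' \<phi> \<mu>"
  by (rule ext) (simp add: augment_def assms degree_adic_coeff)

lemma adic_coeff_self:
  assumes "0 < degree \<phi>"
  shows "adic_coeff \<phi> \<phi> i = (if i = 1 then 1 else 0)"
proof -
  have nz: "\<phi> \<noteq> 0" using assms by auto
  have "adic_coeff \<phi> (1 * \<phi>) i = (if i = 1 then 1 else 0)"
  proof (cases i)
    case (Suc l)
    then show ?thesis using assms
      by (simp only: adic_coeff_mult_Suc[OF nz]) (simp add: adic_coeff_reduced)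
  qed (simp only: adic_coeff_mult_0, simp)
  then show ?thesis by simp
qed

lemma monic_dvd_imp_eq:
  fixes f g :: "'a::field poly"
  assumes "f dvd g" "lead_coeff f = 1" "lead_coeff g = 1" "degree g \<le> degree f"
  shows "g = f"
proof -
  obtain q where q: "g = f * q" using assms(1) ..
  then have nz: "f \<noteq> 0" "q \<noteq> 0" using assms(3) by auto
  then have "degree q = 0" using assms(4) by (simp add: q degree_mult_eq)
  then obtain a where "q = [:a:]" by (metis degree_eq_zeroE)
  then show ?thesis using assms(2,3) by (cases "a = 0") (simp_all add: q)
qed

definition key_monomial :: "(nat \<Rightarrow> 'a::field poly) \<Rightarrow> (nat \<Rightarrow> nat) \<Rightarrow> nat \<Rightarrow> 'a poly" where
  "key_monomial \<phi> e k = (\<Prod>l = 1..<k. \<phi> l ^ e l)"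

lemma key_monomial_1 [simp]: "key_monomial \<phi> e (Suc 0) = 1"
  by (simp add: key_monomial_def)

lemma key_monomial_Suc: "1 \<le> k \<Longrightarrow> key_monomial \<phi> e (Suc k) = key_monomial \<phi> e k * \<phi> k ^ e k"
  by (simp add: key_monomial_def)

lemma key_monomial_cong:
  "(\<And>l. l < k \<Longrightarrow> \<phi> l = \<phi>' l) \<Longrightarrow> (\<And>l. l < k \<Longrightarrow> e l = e' l)
    \<Longrightarrow> key_monomial \<phi> e k = key_monomial \<phi>' e' k"
  unfolding key_monomial_def by (intro prod.cong) auto

locale approximation = residue_extension V0 F W f
  for V0 :: "'a::field \<Rightarrow> 'g::linordered_ab_group_add vext" and F :: "'a set"
    and W :: "'a poly \<Rightarrow> 'g vext" and f :: "'a poly" +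
  assumes f_monic: "lead_coeff f = 1"
    and f_integral: "0 \<le> V0 (coeff f i)"
begin

lemma f_nz: "f \<noteq> 0"
  using f_monic by auto

lemma W_f: "W f = Infty"
  by (simp add: W_eq_Infty_iff)

lemma W_power_mono:
  assumes "0 \<le> W x" "i \<le> l"
  shows "W (x ^ i) \<le> W (x ^ l)"
proof -
  have nn: "0 \<le> W (x ^ m)" for m
    by (induction m) (use add_mono[OF assms(1)] in \<open>auto simp: W.mult\<close>)
  have "x ^ l = x ^ i * x ^ (l - i)" using assms(2) by (simp flip: power_add)
  then show ?thesis using add_left_mono[OF nn[of "l - i"], of "W (x ^ i)"] by (simp add: W.mult)
qed

text \<open>For negative \<open>W z\<close> the leading term of the monic integral \<open>f\<close>
  would have strictly least value, making \<open>W f\<close> finite.\<close>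

lemma W_linear_nonneg: "0 \<le> W [:0, 1:]"
proof (rule ccontr)
  let ?z = "[:0, 1:] :: 'a poly"
  assume "\<not> 0 \<le> W ?z"
  then have neg: "W ?z < 0" by simp
  then have fin: "W ?z \<noteq> Infty" by auto
  have neg_power: "W (?z ^ Suc m) < 0" for m
  proof (induction m)
    case (Suc m)
    have "W (?z ^ Suc m) + W ?z < 0 + 0"
      using Suc neg by (intro vext_add_le_less_mono) auto
    then show ?case by (simp only: power_Suc2[of ?z "Suc m"] W.mult) simp
  qed (use neg in simp)
  have fin_power: "W (?z ^ m) \<noteq> Infty" for m
    using fin by (rule W.power_neq_Infty)
  have lead: "W (smult (coeff f (degree f)) (?z ^ degree f)) = W (?z ^ degree f)"
    using f_monic by simp
  have "W (\<Sum>i\<le>degree f. smult (coeff f i) (?z ^ i)) = W (smult (coeff f (degree f)) (?z ^ degree f))"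
  proof (rule W.sum_eq)
    fix i assume i: "i \<in> {..degree f}" "i \<noteq> degree f"
    then obtain m where m: "degree f = i + Suc m" using less_imp_Suc_add[of i "degree f"] by auto
    have "?z ^ degree f = ?z ^ i * ?z ^ Suc m" unfolding m by (rule power_add)
    then have "W (?z ^ degree f) = W (?z ^ i) + W (?z ^ Suc m)" by (simp only: W.mult)
    also have "\<dots> < W (?z ^ i) + 0" using vext_add_left_less_iff[OF fin_power] neg_power by blast
    also have "\<dots> \<le> W (?z ^ i) + V0 (coeff f i)" using f_integral by (rule add_left_mono)
    finally show "W (smult (coeff f (degree f)) (?z ^ degree f)) < W (smult (coeff f i) (?z ^ i))"
      unfolding lead by (simp add: W_smult add.commute)
  qed (use lead fin_power in auto)
  also have "(\<Sum>i\<le>degree f. smult (coeff f i) (?z ^ i)) = f"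
    by (simp flip: monom_altdef add: poly_as_sum_of_monoms)
  finally show False using lead fin_power W_f by metis
qed

text \<open>For the base of the construction all digits are constants, and these form a
  field.\<close>

lemma value_truncation_linear: "value_truncation W [:0, 1:]"
proof unfold_locales
  have const: "\<exists>c. a = [:c:]" if "degree a < degree ([:0, 1:] :: 'a poly)" for a :: "'a poly"
    using that by (metis degree_eq_zeroE degree_pCons_eq_if less_one one_neq_zero One_nat_def
        degree_0 pCons_eq_0_iff)
  show "W a \<noteq> Infty" if "degree a < degree ([:0, 1:] :: 'a poly)" "a \<noteq> 0" for a
    using const[OF that(1)] that(2) V0_eq_Infty by (auto simp: W_const)
  show "W (a * b mod [:0, 1:]) = W (a * b)"
    if "degree a < degree ([:0, 1:] :: 'a poly)" "degree b < degree ([:0, 1:] :: 'a poly)" for a b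
    using const[OF that(1)] const[OF that(2)] by (auto simp: mod_poly_less)
  show "\<exists>b. degree b < degree ([:0, 1:] :: 'a poly) \<and> W (a * b) = 0"
    if a: "degree a < degree ([:0, 1:] :: 'a poly)" "a \<noteq> 0" for a
  proof -
    obtain c where "a = [:c:]" using const[OF a(1)] ..
    then show ?thesis using a(2) by (intro exI[of _ "[:inverse c:]"]) (simp add: W_const)
  qed
qed simp

section \<open>Construction of the key polynomials\<close>

definition next_key ::
  "(nat \<Rightarrow> 'a poly) \<Rightarrow> (nat \<Rightarrow> nat) \<Rightarrow> nat \<Rightarrow> 'a poly \<Rightarrow> nat \<Rightarrow> 'a \<Rightarrow> (nat \<Rightarrow> nat) \<Rightarrow> bool" where
  "next_key \<phi> \<nu> i \<psi> n c e \<longleftrightarrow>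
     key_step W (\<phi> i) (smult c (key_monomial \<phi> e i)) n \<and>
     \<psi> = \<phi> i ^ n - smult c (key_monomial \<phi> e i) \<and>
     (\<forall>l\<in>{1..<i}. e l < \<nu> l) \<and> 0 \<le> V0 c"

text \<open>Dependence on earlier entries only is what the recursive choice in
  \<open>key_sequence_exists\<close> requires.\<close>

lemma next_key_cong:
  assumes "\<And>l. l \<le> i \<Longrightarrow> \<phi> l = \<phi>' l" "\<And>l. l < i \<Longrightarrow> \<nu> l = \<nu>' l"
  shows "next_key \<phi> \<nu> i \<psi> n c e \<longleftrightarrow> next_key \<phi>' \<nu>' i \<psi> n c e"
proof -
  have "key_monomial \<phi> e i = key_monomial \<phi>' e i"
    using assms(1) by (intro key_monomial_cong) auto
  then show ?thesis using assms by (auto simp: next_key_def)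
qed

text \<open>A sequence of \<open>k\<close> key polynomials arises from \<open>k - 1\<close> steps;
  \<open>j l i\<close> is the exponent of \<open>\<phi> l\<close> in step \<open>i\<close>.\<close>

definition key_sequence ::
  "(nat \<Rightarrow> 'a poly) \<Rightarrow> (nat \<Rightarrow> nat) \<Rightarrow> (nat \<Rightarrow> 'a) \<Rightarrow> (nat \<Rightarrow> nat \<Rightarrow> nat) \<Rightarrow> nat \<Rightarrow> bool" where
  "key_sequence \<phi> n c j k \<longleftrightarrow> \<phi> 1 = [:0, 1:] \<and>
     (\<forall>i\<in>{1..<k}. next_key \<phi> n i (\<phi> (Suc i)) (n i) (c i) (\<lambda>l. j l i))"

lemma key_sequence_key_step:
  "key_sequence \<phi> n c j k \<Longrightarrow> 1 \<le> i \<Longrightarrow> i < k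
    \<Longrightarrow> key_step W (\<phi> i) (smult (c i) (key_monomial \<phi> (\<lambda>l. j l i) i)) (n i)"
  by (auto simp: key_sequence_def next_key_def)

lemma key_sequence_next:
  "key_sequence \<phi> n c j k \<Longrightarrow> 1 \<le> i \<Longrightarrow> i < k
    \<Longrightarrow> \<phi> (Suc i) = \<phi> i ^ n i - smult (c i) (key_monomial \<phi> (\<lambda>l. j l i) i)"
  by (auto simp: key_sequence_def next_key_def)

lemma key_sequence_mono: "key_sequence \<phi> n c j k \<Longrightarrow> i \<le> k \<Longrightarrow> key_sequence \<phi> n c j i"
  by (auto simp: key_sequence_def)

text \<open>The last two clauses prepare the next step: monomials with bounded exponents realise, up
  to constants, all finite values below \<open>degree (\<phi> k)\<close>, and the bound on their own
  values makes the next constant integral.\<close>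

lemma key_sequence_invariant:
  assumes "key_sequence \<phi> n c j k" "1 \<le> k"
  shows "value_truncation W (\<phi> k) \<and> lead_coeff (\<phi> k) = 1 \<and> 0 \<le> W (\<phi> k) \<and>
    (\<forall>e. (\<forall>l\<in>{1..<k}. e l < n l) \<longrightarrow>
       degree (key_monomial \<phi> e k) < degree (\<phi> k) \<and> W (key_monomial \<phi> e k) \<le> W (\<phi> k)) \<and>
    (\<forall>a. degree a < degree (\<phi> k) \<and> a \<noteq> 0 \<longrightarrow>
       (\<exists>b e. b \<noteq> 0 \<and> (\<forall>l\<in>{1..<k}. e l < n l) \<and> W a = W (smult b (key_monomial \<phi> e k))))"
  using assms(2,1)
proof (induction k rule: nat_induct_at_least)
  case base
  then have "\<phi> 1 = [:0, 1:]" by (simp add: key_sequence_def)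
  show ?case unfolding \<open>\<phi> 1 = [:0, 1:]\<close>
  proof (intro conjI allI impI)
    fix a :: "'a poly" assume a: "degree a < degree ([:0, 1:] :: 'a poly) \<and> a \<noteq> 0"
    then obtain b where "a = [:b:]" by (auto elim: degree_eq_zeroE)
    then show "\<exists>b e. b \<noteq> 0 \<and> (\<forall>l\<in>{1..<1}. e l < n l) \<and> W a = W (smult b (key_monomial \<phi> e 1))"
      using a by (intro exI[of _ b] exI[of _ "\<lambda>_. 0"]) (simp add: one_pCons)
  qed (simp_all add: value_truncation_linear W_linear_nonneg)
next
  case (Suc k)
  define C where "C = smult (c k) (key_monomial \<phi> (\<lambda>l. j l k) k)"
  have step: "key_step W (\<phi> k) C (n k)"
    using key_sequence_key_step[OF Suc.prems] Suc.hyps by (simp add: C_def)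
  have psi: "\<phi> (Suc k) = \<phi> k ^ n k - C"
    using key_sequence_next[OF Suc.prems] Suc.hyps by (simp add: C_def)
  interpret key_step W "\<phi> k" C "n k" by (rule step)
  have seq: "key_sequence \<phi> n c j k" using key_sequence_mono[OF Suc.prems] by simp
  note IH = Suc.IH[OF seq]
  have lc: "lead_coeff (\<phi> k) = 1" and nn: "0 \<le> W (\<phi> k)" using IH by blast+
  have IH_mono: "degree (key_monomial \<phi> e k) < degree (\<phi> k)" "W (key_monomial \<phi> e k) \<le> W (\<phi> k)"
    if "\<forall>l\<in>{1..<k}. e l < n l" for e using IH that by blast+
  have IH_rep: "\<exists>b e. b \<noteq> 0 \<and> (\<forall>l\<in>{1..<k}. e l < n l) \<and> W a = W (smult b (key_monomial \<phi> e k))"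
    if "degree a < degree (\<phi> k)" "a \<noteq> 0" for a using IH that by blast
  have mono: "degree (key_monomial \<phi> e (Suc k)) < degree \<psi> \<and>
      W (key_monomial \<phi> e (Suc k)) \<le> W \<psi>" if e: "\<forall>l\<in>{1..<Suc k}. e l < n l" for e
  proof -
    have ek: "e k < n k" and e': "\<forall>l\<in>{1..<k}. e l < n l" using e Suc.hyps by auto
    have "degree (key_monomial \<phi> e (Suc k)) < degree \<psi>"
      unfolding key_monomial_Suc[OF Suc.hyps]
      by (rule degree_reduced_times_power[OF IH_mono(1)[OF e'] ek])
    moreover have "W (key_monomial \<phi> e (Suc k)) \<le> W \<psi>"
    proof -
      \<comment> \<open>The earlier factors are worth at most one more factor
        \<open>\<phi> k\<close>, for which \<open>e k < n k\<close> leaves room.\<close>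
      have "W (key_monomial \<phi> e (Suc k)) \<le> W (\<phi> k) + W (\<phi> k ^ e k)"
        unfolding key_monomial_Suc[OF Suc.hyps] W.mult by (intro add_right_mono IH_mono(2) e')
      also have "\<dots> = W (\<phi> k ^ Suc (e k))" by (simp add: W.mult)
      also have "\<dots> \<le> W (\<phi> k ^ n k)" using nn ek by (intro W_power_mono) auto
      also have "\<dots> \<le> W \<psi>" using W_psi by simp
      finally show ?thesis .
    qed
    ultimately show ?thesis ..
  qed
  have "0 \<le> W (\<phi> k ^ n k)" using W_power_mono[OF nn, of 0 "n k"] by simp
  then have nonneg: "0 \<le> W \<psi>" using W_psi by simp
  have rep: "\<exists>b e. b \<noteq> 0 \<and> (\<forall>l\<in>{1..<Suc k}. e l < n l) \<and>
      W a = W (smult b (key_monomial \<phi> e (Suc k)))" if a: "degree a < degree \<psi>" "a \<noteq> 0" for a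
  proof -
    obtain d s where d: "degree d < degree (\<phi> k)" "s < n k" "T a = W (d * \<phi> k ^ s)"
      using T_value[OF a(2)] by blast
    have "d \<noteq> 0" using d(3) a(2) T_eq_Infty_iff[of a] by auto
    then obtain b e where be: "b \<noteq> 0" "\<forall>l\<in>{1..<k}. e l < n l" "W d = W (smult b (key_monomial \<phi> e k))"
      using IH_rep[OF d(1)] by blast
    have eq: "key_monomial \<phi> (e(k := s)) k = key_monomial \<phi> e k"
      by (intro key_monomial_cong) auto
    have "W a = W (smult b (key_monomial \<phi> (e(k := s)) (Suc k)))"
      unfolding key_monomial_Suc[OF Suc.hyps] eq
      using d(3) be(3) T_below[OF a(1)] by (simp add: W.mult W_smult add.assoc)
    moreover have "\<forall>l\<in>{1..<Suc k}. (e(k := s)) l < n l" using be(2) d(2) by auto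
    ultimately show ?thesis using be(1) by blast
  qed
  show ?case unfolding psi
  proof (intro conjI allI impI)
    show "value_truncation W \<psi>" by (rule value_truncation_psi)
    show "lead_coeff \<psi> = 1" using lc by (rule lead_coeff_psi)
  qed (use nonneg mono rep in blast)+
qed

lemmas key_sequence_truncation = key_sequence_invariant[THEN conjunct1]
lemmas key_sequence_monic = key_sequence_invariant[THEN conjunct2, THEN conjunct1]

text \<open>Otherwise \<open>f\<close> would be a nonzero digit, hence of finite value.\<close>

lemma key_sequence_degree_le:
  assumes "key_sequence \<phi> n c j k" "1 \<le> k"
  shows "degree (\<phi> k) \<le> degree f"
proof (rule ccontr)
  assume "\<not> ?thesis"
  then show False
    using value_truncation.W_reduced_fin[OF key_sequence_truncation[OF assms], of f] f_nz W_f by simp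
qed

lemma next_key_exists:
  assumes seq: "key_sequence \<phi> n c j k" "1 \<le> k" and fin: "W (\<phi> k) \<noteq> Infty"
  shows "\<exists>\<psi> m b e. next_key \<phi> n k \<psi> m b e"
proof -
  note inv = key_sequence_invariant[OF seq]
  have "finite_truncation W (\<phi> k)"
    using inv fin by (simp add: finite_truncation_def finite_truncation_axioms_def)
  then interpret finite_truncation W "\<phi> k" .
  \<comment> \<open>The least such \<open>m\<close> is the order of the value of
    \<open>\<phi> k\<close> modulo \<open>reduced_values\<close>.\<close>
  define P where "P m \<longleftrightarrow> 0 < m \<and> (\<exists>d. degree d < degree (\<phi> k) \<and> W d = W (\<phi> k ^ m))" for m
  have "\<exists>m. P m" using ex_value_order[OF f_nz W_f] by (auto simp: P_def)
  then obtain m where m: "P m" "\<And>i. i < m \<Longrightarrow> \<not> P i" by (metis exists_least_iff)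
  then obtain d where d: "degree d < degree (\<phi> k)" "W d = W (\<phi> k ^ m)" and m_pos: "0 < m"
    by (auto simp: P_def)
  have "d \<noteq> 0" using d(2) W_phi_power_fin[of m] W.zero by metis
  then obtain b e where be: "b \<noteq> 0" "\<forall>l\<in>{1..<k}. e l < n l" "W d = W (smult b (key_monomial \<phi> e k))"
    using inv d(1) by blast
  \<comment> \<open>The unit matches the residue classes, so that the difference gains
    value.\<close>
  obtain u where u: "V0 u = 0" "W (\<phi> k ^ m) < W (\<phi> k ^ m - smult u (smult b (key_monomial \<phi> e k)))"
    using equal_values_unit[of "\<phi> k ^ m" "smult b (key_monomial \<phi> e k)"] be(3) d(2) W_phi_power_fin[of m]
    by metis
  define c' where "c' = u * b"
  define C where "C = smult c' (key_monomial \<phi> e k)"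
  have WC: "W C = W (\<phi> k ^ m)" using u(1) be(3) d(2) by (simp add: C_def c'_def W_smult mult)
  have "key_step W (\<phi> k) C m"
  proof unfold_locales
    show "degree C < degree (\<phi> k)"
      using inv be(2) degree_smult_le[of c' "key_monomial \<phi> e k"] unfolding C_def by fastforce
    show "W a \<noteq> W (\<phi> k ^ i)" if "0 < i" "i < m" "degree a < degree (\<phi> k)" for i a
      using m(2)[of i] that by (auto simp: P_def)
    show "W (\<phi> k ^ m) < W (\<phi> k ^ m - C)" using u(2) by (simp add: C_def c'_def)
  qed (use m_pos WC in auto)
  \<comment> \<open>A negative value of \<open>c'\<close> would put the monomial above
    \<open>\<phi> k ^ m\<close>, although its value is at most that of
    \<open>\<phi> k\<close>.\<close>
  moreover have "0 \<le> V0 c'"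
  proof (rule ccontr)
    let ?M = "key_monomial \<phi> e k"
    assume "\<not> 0 \<le> V0 c'"
    then have neg: "V0 c' < 0" by simp
    have sum: "V0 c' + W ?M = W (\<phi> k ^ m)" using WC by (simp add: C_def W_smult)
    then have "W ?M \<noteq> Infty" using W_phi_power_fin[of m] by (metis vext_Infty_add(2))
    then have "W ?M + V0 c' < W ?M + 0" using neg vext_add_left_less_iff by blast
    then have "W (\<phi> k ^ m) < W ?M" using sum by (simp add: add.commute)
    also have "W ?M \<le> W (\<phi> k ^ 1)" using inv be(2) by simp
    also have "\<dots> \<le> W (\<phi> k ^ m)" using inv m_pos by (intro W_power_mono) auto
    finally show False by simp
  qed
  ultimately show ?thesis unfolding next_key_def C_def using be(2) by blast
qed

text \<open>The data are chosen once for all lengths. Entries after an infinite value are arbitrary,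
  which explains the premise.\<close>

lemma key_sequence_exists:
  "\<exists>\<phi> n c j. \<forall>k. (\<forall>i\<in>{1..<k}. W (\<phi> i) \<noteq> Infty) \<longrightarrow> key_sequence \<phi> n c j k"
proof -
  \<comment> \<open>Entry \<open>k\<close> of \<open>s\<close> is \<open>\<phi> k\<close> with the data \<open>n\<close>, \<open>c\<close>, \<open>j\<close> of index \<open>k - 1\<close> it is built from.\<close>
  define key where "key s i = fst (s i)" for s :: "nat \<Rightarrow> 'a poly \<times> nat \<times> 'a \<times> (nat \<Rightarrow> nat)" and i
  define idx where "idx s i = fst (snd (s (Suc i)))" for s :: "nat \<Rightarrow> 'a poly \<times> nat \<times> 'a \<times> (nat \<Rightarrow> nat)" and i
  define cf where "cf s i = fst (snd (snd (s (Suc i))))" for s :: "nat \<Rightarrow> 'a poly \<times> nat \<times> 'a \<times> (nat \<Rightarrow> nat)" and i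
  define ex where "ex s l i = snd (snd (snd (s (Suc i)))) l" for s :: "nat \<Rightarrow> 'a poly \<times> nat \<times> 'a \<times> (nat \<Rightarrow> nat)" and l i
  define P where "P s k r \<longleftrightarrow> (k = 1 \<longrightarrow> fst r = [:0, 1:]) \<and>
     (2 \<le> k \<and> (\<forall>i\<in>{1..<k}. W (key s i) \<noteq> Infty) \<longrightarrow>
        next_key (key s) (idx s) (k - 1) (fst r) (fst (snd r)) (fst (snd (snd r))) (snd (snd (snd r))))"
    for s k r
  have "\<exists>s. \<forall>k. P s k (s k)"
  \<comment> \<open>A new entry depends on all earlier ones, not just on its predecessor.\<close>
  proof (rule dependent_wf_choice[of less_than])
    fix s t :: "nat \<Rightarrow> 'a poly \<times> nat \<times> 'a \<times> (nat \<Rightarrow> nat)" and k r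
    assume eq: "\<And>i. (i, k) \<in> less_than \<Longrightarrow> s i = t i"
    have "next_key (key s) (idx s) (k - 1) \<psi> m b e \<longleftrightarrow> next_key (key t) (idx t) (k - 1) \<psi> m b e"
      if "2 \<le> k" for \<psi> m b e
      using eq that by (intro next_key_cong) (auto simp: key_def idx_def)
    moreover have "(\<forall>i\<in>{1..<k}. W (key s i) \<noteq> Infty) \<longleftrightarrow> (\<forall>i\<in>{1..<k}. W (key t i) \<noteq> Infty)"
      using eq by (auto simp: key_def)
    ultimately show "P s k r = P t k r" unfolding P_def by blast
  next
    fix k and s :: "nat \<Rightarrow> 'a poly \<times> nat \<times> 'a \<times> (nat \<Rightarrow> nat)"
    assume hist: "\<And>i. (i, k) \<in> less_than \<Longrightarrow> P s i (s i)"
    show "\<exists>r. P s k r"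
    proof (cases "2 \<le> k \<and> (\<forall>i\<in>{1..<k}. W (key s i) \<noteq> Infty)")
      case True
      have "key_sequence (key s) (idx s) (cf s) (ex s) (k - 1)"
        unfolding key_sequence_def
      proof (intro conjI ballI)
        show "key s 1 = [:0, 1:]" using hist[of 1] True by (simp add: P_def key_def)
        fix i assume "i \<in> {1..<k - 1}"
        then have "1 \<le> i" "Suc i < k" by auto
        then show "next_key (key s) (idx s) i (key s (Suc i)) (idx s i) (cf s i) (\<lambda>l. ex s l i)"
          using hist[of "Suc i"] True by (simp add: P_def key_def idx_def cf_def ex_def)
      qed
      then obtain \<psi> m b e where "next_key (key s) (idx s) (k - 1) \<psi> m b e"
        using next_key_exists[of "key s" "idx s" "cf s" "ex s" "k - 1"] True by force
      then have "P s k (\<psi>, m, b, e)" using True by (auto simp: P_def)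
      then show ?thesis ..
    next
      case False
      \<comment> \<open>This entry starts the sequence at index \<open>1\<close> and is a dummy at
        index \<open>0\<close> and after an infinite value.\<close>
      then have "P s k ([:0, 1:], undefined)" by (auto simp: P_def)
      then show ?thesis ..
    qed
  qed simp
  then obtain s where s: "\<And>k. P s k (s k)" by blast
  have "key_sequence (key s) (idx s) (cf s) (ex s) k"
    if "\<forall>i\<in>{1..<k}. W (key s i) \<noteq> Infty" for k
    unfolding key_sequence_def
  proof (intro conjI ballI)
    show "key s 1 = [:0, 1:]" using s[of 1] by (simp add: P_def key_def)
    fix i assume "i \<in> {1..<k}"
    then show "next_key (key s) (idx s) i (key s (Suc i)) (idx s i) (cf s i) (\<lambda>l. ex s l i)"
      using s[of "Suc i"] that by (simp add: P_def key_def[of s "Suc i"] idx_def[of s i] cf_def ex_def)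
  qed
  then show ?thesis by blast
qed


section \<open>The stages as approximants\<close>

abbreviation stage :: "(nat \<Rightarrow> 'a poly) \<Rightarrow> nat \<Rightarrow> 'a poly \<Rightarrow> 'g vext" where
  "stage \<phi> i \<equiv> augment W (\<phi> i) (W (\<phi> i))"

lemma stage_1:
  assumes "key_sequence \<phi> n c j k"
  shows "stage \<phi> 1 = first_stage V0 (W (\<phi> 1))"
  using assms first_stage_eq_augment[of W V0, OF W_const] by (simp add: key_sequence_def)

text \<open>The stages are defined from \<open>W\<close> without recursion. The inductive
  description returns because stage \<open>i\<close> agrees with \<open>W\<close> on all digits for
  \<open>\<phi> (Suc i)\<close>.\<close>

lemma stage_Suc:
  assumes "key_sequence \<phi> n c j k" "1 \<le> i" "i < k"
  shows "stage \<phi> (Suc i) = augment (stage \<phi> i) (\<phi> (Suc i)) (W (\<phi> (Suc i)))"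
proof -
  interpret key_step W "\<phi> i" "smult (c i) (key_monomial \<phi> (\<lambda>l. j l i) i)" "n i"
    by (rule key_sequence_key_step[OF assms])
  show ?thesis unfolding key_sequence_next[OF assms]
    by (rule augment_cong[OF degree_psi_pos]) (simp add: T_below flip: T_def)
qed

lemma key_polynomial_stage:
  assumes "key_sequence \<phi> n c j k" "1 \<le> i" "i < k"
  shows "key_polynomial (stage \<phi> i) (\<phi> i) (\<phi> (Suc i)) (W (\<phi> (Suc i)))"
proof -
  interpret key_step W "\<phi> i" "smult (c i) (key_monomial \<phi> (\<lambda>l. j l i) i)" "n i"
    by (rule key_sequence_key_step[OF assms])
  have "lead_coeff (\<phi> i) = 1"
    using key_sequence_monic[OF key_sequence_mono[OF assms(1)]] assms by simp
  then show ?thesis unfolding key_sequence_next[OF assms]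
    using key_polynomial_psi by (simp add: T_def)
qed

lemma degree_ratio:
  assumes "key_sequence \<phi> n c j k" "1 \<le> i" "i < k"
  shows "degree (\<phi> (Suc i)) div degree (\<phi> i) = n i"
proof -
  interpret key_step W "\<phi> i" "smult (c i) (key_monomial \<phi> (\<lambda>l. j l i) i)" "n i"
    by (rule key_sequence_key_step[OF assms])
  show ?thesis unfolding key_sequence_next[OF assms] using degree_psi degree_pos by simp
qed

text \<open>The two terms of the binomial already form the expansion, and \<open>W_c\<close> gives
  them equal values.\<close>

lemma homogeneous_stage:
  assumes seq: "key_sequence \<phi> n c j k" "1 \<le> i" "i < k"
  shows "homogeneous \<phi> i (stage \<phi> i) (\<phi> (Suc i))"
proof -
  let ?M = "key_monomial \<phi> (\<lambda>l. j l i) i"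
  interpret key_step W "\<phi> i" "smult (c i) ?M" "n i"
    by (rule key_sequence_key_step[OF seq])
  have bound: "j l i < n l" if "l \<in> {1..<i}" for l
    using seq that by (auto simp: key_sequence_def next_key_def)
  have c_nz: "c i \<noteq> 0" using W_c W_phi_power_fin[of "n i"] W.zero by (metis smult_0_left)
  \<comment> \<open>The vectors must vanish outside \<open>{1..i}\<close>. Exponent
    \<open>n i\<close> at position \<open>i\<close> is admissible because the last exponent of an
    expansion is unbounded.\<close>
  define e1 where "e1 = (\<lambda>l. if l = i then n i else 0)"
  define e2 where "e2 = (\<lambda>l. if l \<in> {1..<i} then j l i else 0)"
  define a where "a = (\<lambda>e. if e = e1 then 1 else if e = e2 then - c i else 0)"
  have "e1 i \<noteq> e2 i" using n_pos by (simp add: e1_def e2_def)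
  then have ne: "e1 \<noteq> e2" by auto
  have supp: "{e. a e \<noteq> 0} = {e1, e2}" using c_nz by (auto simp: a_def)
  have key_term: "key_term \<phi> i b e = smult b (key_monomial \<phi> e i * \<phi> i ^ e i)" for b e
    using key_monomial_Suc[OF seq(2), of \<phi> e]
    by (simp add: key_term_def key_monomial_def atLeastLessThanSuc_atLeastAtMost)
  have "key_monomial \<phi> e1 i = 1" unfolding key_monomial_def by (rule prod.neutral) (simp add: e1_def)
  then have t1: "key_term \<phi> i (a e1) e1 = \<phi> i ^ n i" by (simp add: key_term a_def e1_def)
  have "key_monomial \<phi> e2 i = ?M" unfolding key_monomial_def by (rule prod.cong) (simp_all add: e2_def)
  then have t2: "key_term \<phi> i (a e2) e2 = - smult (c i) ?M"
    using ne by (simp add: key_term a_def e2_def)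
  have "key_expansion \<phi> i (\<phi> (Suc i)) a"
    unfolding key_expansion_def
  proof (intro conjI allI impI)
    show "finite {m. a m \<noteq> 0}" by (simp add: supp)
    show "\<phi> (Suc i) = (\<Sum>m | a m \<noteq> 0. key_term \<phi> i (a m) m)"
      unfolding supp using ne key_sequence_next[OF seq] by (simp add: t1 t2)
    fix m assume "a m \<noteq> 0"
    then have m: "m = e1 \<or> m = e2" using supp by blast
    then show "m l = 0" if "l \<notin> {1..i}" for l using that seq(2) by (auto simp: e1_def e2_def)
    show "\<forall>l\<in>{1..<i}. m l < degree (\<phi> (Suc l)) div degree (\<phi> l)"
    proof
      fix l assume l: "l \<in> {1..<i}"
      then have "degree (\<phi> (Suc l)) div degree (\<phi> l) = n l"
        using degree_ratio[OF seq(1)] seq(3) by simp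
      then show "m l < degree (\<phi> (Suc l)) div degree (\<phi> l)"
        using m l bound[OF l] by (auto simp: e1_def e2_def)
    qed
  qed
  moreover have "stage \<phi> i (key_term \<phi> i (a m) m) = W (\<phi> i ^ n i)" if "a m \<noteq> 0" for m
  proof -
    have "m = e1 \<or> m = e2" using that supp by blast
    then show ?thesis
      using T_phi_power[of "n i"] T_reduced[OF degree_c] W_c
      by (auto simp: t1 t2 simp flip: T_def)
  qed
  ultimately show ?thesis unfolding homogeneous_def by metis
qed

text \<open>Infinite value means divisibility by \<open>f\<close>, and both polynomials are monic
  with \<open>degree (\<phi> k) \<le> degree f\<close>.\<close>

lemma last_key_eq_f:
  assumes "key_sequence \<phi> n c j k" "1 \<le> k" "W (\<phi> k) = Infty"
  shows "\<phi> k = f"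
proof (rule monic_dvd_imp_eq)
  show "f dvd \<phi> k" using assms(3) W_eq_Infty_iff by simp
qed (use f_monic key_sequence_monic[OF assms(1,2)] key_sequence_degree_le[OF assms(1,2)] in auto)

text \<open>At exponent \<open>0\<close> the digit of \<open>f\<close> is zero, and at positive
  exponents the key value is infinite.\<close>

lemma augment_self_Infty: "augment W f Infty f = Infty"
proof -
  have *: "W (adic_coeff f f i) + nmult i Infty = Infty" for i
    by (cases i) (simp_all add: adic_coeff_self degree_f_pos nmult_Suc)
  show ?thesis by (simp only: augment_def *) (simp add: image_constant_conv)
qed

text \<open>The zero digit at exponent \<open>0\<close> counts, so the exponents are
  \<open>0\<close> and \<open>1\<close>.\<close>

lemma proj_self: "V f = Infty \<Longrightarrow> V 0 = Infty \<Longrightarrow> proj f f V = 1"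
proof -
  assume V: "V f = Infty" "V 0 = Infty"
  have "proj_exponents f f V = {0, 1}"
    unfolding proj_exponents_def
    using V by (auto simp: adic_coeff_self degree_f_pos intro: exI[of _ 1])
  then show ?thesis by (simp add: proj_def)
qed

lemma proj_stage_pos:
  assumes "key_sequence \<phi> n c j k" "1 \<le> k"
  shows "0 < proj f (\<phi> k) (stage \<phi> k)"
proof (cases "W (\<phi> k) = Infty")
  case True
  then have "\<phi> k = f" using last_key_eq_f assms by blast
  then show ?thesis
    using proj_self[of "augment W f Infty"] augment_self_Infty True
    by (simp add: augment_def)
next
  case False
  then have "finite_truncation W (\<phi> k)"
    using key_sequence_truncation[OF assms]
    by (simp add: finite_truncation_def finite_truncation_axioms_def)
  then interpret finite_truncation W "\<phi> k" .
  show ?thesis using proj_pos[OF f_nz W_f] by (simp add: T_def)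
qed

lemma approximant_stage:
  assumes "key_sequence \<phi> n c j k" "1 \<le> k"
  shows "approximant V0 f \<phi> (\<lambda>i. W (\<phi> i)) (stage \<phi>) k"
  unfolding approximant_def
proof (intro conjI ballI)
  show "\<phi> 1 = [:0, 1:]" using assms by (simp add: key_sequence_def)
  show "stage \<phi> 1 = first_stage V0 (W (\<phi> 1))" by (rule stage_1[OF assms(1)])
  show "W (\<phi> i) \<noteq> Infty" if "i \<in> {1..<k}" for i
  proof -
    have "key_step W (\<phi> i) (smult (c i) (key_monomial \<phi> (\<lambda>l. j l i) i)) (n i)"
      using that key_sequence_key_step[OF assms(1)] by simp
    then interpret key_step W "\<phi> i" "smult (c i) (key_monomial \<phi> (\<lambda>l. j l i) i)" "n i" .
    show ?thesis by (rule W_phi_fin)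
  qed
  fix i assume "i \<in> {2..k}"
  then have i: "1 \<le> i - 1" "i - 1 < k" "Suc (i - 1) = i" by auto
  show "key_polynomial (stage \<phi> (i - 1)) (\<phi> (i - 1)) (\<phi> i) (W (\<phi> i))"
    using key_polynomial_stage[OF assms(1) i(1,2)] i(3) by simp
  show "homogeneous \<phi> (i - 1) (stage \<phi> (i - 1)) (\<phi> i)"
    using homogeneous_stage[OF assms(1) i(1,2)] i(3) by simp
  show "stage \<phi> i = augment (stage \<phi> (i - 1)) (\<phi> i) (W (\<phi> i))"
    using stage_Suc[OF assms(1) i(1,2)] i(3) by simp
qed (use assms proj_stage_pos in auto)

section \<open>Value groups of the stages and their indices\<close>

lemma stage_group_eq:
  assumes "key_sequence \<phi> n c j k" "i < k"
  shows "stage_group V0 (stage \<phi>) i = value_truncation.reduced_values W (\<phi> (Suc i))"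
proof (cases i)
  case 0
  interpret value_truncation W "[:0, 1:]" by (rule value_truncation_linear)
  have "(\<exists>a. V0 a = Fin x) \<longleftrightarrow> x \<in> reduced_values" for x
  proof
    assume "\<exists>a. V0 a = Fin x"
    then obtain a where "V0 a = Fin x" ..
    then show "x \<in> reduced_values"
      by (auto simp: reduced_values_def W_const intro!: exI[of _ "[:a:]"])
  next
    assume "x \<in> reduced_values"
    then obtain a where "degree a = 0" "W a = Fin x" by (auto simp: reduced_values_def)
    then show "\<exists>a. V0 a = Fin x" using W_const by (metis degree_eq_zeroE)
  qed
  then have "value_group V0 = reduced_values" by (rule value_group_eq_reduced_values)
  then show ?thesis using 0 assms(1) by (simp add: stage_group_def key_sequence_def)
next
  case (Suc m)
  then have "1 \<le> i" by simp
  interpret key_step W "\<phi> i" "smult (c i) (key_monomial \<phi> (\<lambda>l. j l i) i)" "n i"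
    by (rule key_sequence_key_step[OF assms(1) \<open>1 \<le> i\<close> assms(2)])
  have "value_group (stage \<phi> i) = psi.reduced_values"
    using value_group_T by (simp add: T_def)
  then show ?thesis
    using \<open>1 \<le> i\<close> key_sequence_next[OF assms(1) \<open>1 \<le> i\<close> assms(2)]
    by (simp add: stage_group_def)
qed

lemma has_index_stage_group:
  assumes "key_sequence \<phi> n c j k" "1 \<le> i" "i < k"
  shows "has_index (stage_group V0 (stage \<phi>) i) (stage_group V0 (stage \<phi>) (i - 1)) (n i)"
proof -
  interpret key_step W "\<phi> i" "smult (c i) (key_monomial \<phi> (\<lambda>l. j l i) i)" "n i"
    by (rule key_sequence_key_step[OF assms])
  have "stage_group V0 (stage \<phi>) (i - 1) = reduced_values"
    using stage_group_eq[OF assms(1), of "i - 1"] assms by simp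
  then show ?thesis
    using has_index_reduced_values stage_group_eq[OF assms(1,3)] key_sequence_next[OF assms] by simp
qed

section \<open>The length of the sequence\<close>

lemma approximant_sequence_exists:
  "\<exists>(len :: enat) \<phi> V c n j.
     approximant_sequence V0 f len \<phi> (\<lambda>i. W (\<phi> i)) V \<and>
     \<phi> 1 = [:0, 1:] \<and>
     (\<forall>i\<ge>2. enat i \<le> len \<longrightarrow>
        \<phi> i = \<phi> (i - 1) ^ n (i - 1) - smult (c (i - 1)) (\<Prod>l = 1..i - 2. \<phi> l ^ j l (i - 1)) \<and>
        c (i - 1) \<in> valuation_ring V0 \<and>
        has_index (stage_group V0 V (i - 1)) (stage_group V0 V (i - 2)) (n (i - 1)) \<and>
        (\<forall>l\<in>{1..i - 2}. j l (i - 1) < n l)) \<and>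
     ((\<exists>k. len = enat k \<and> \<phi> k = f \<and> V k f = Infty) \<or> len = \<infinity>)"
proof -
  obtain \<phi> n c j where seq: "\<And>k. \<forall>i\<in>{1..<k}. W (\<phi> i) \<noteq> Infty \<Longrightarrow> key_sequence \<phi> n c j k"
    using key_sequence_exists by blast
  \<comment> \<open>The sequence stops at the first index with an infinite key value. Index
    \<open>0\<close> is excluded because its entry is arbitrary.\<close>
  define Q where "Q k \<longleftrightarrow> 1 \<le> k \<and> W (\<phi> k) = Infty" for k
  define len where "len = (if \<exists>k. Q k then enat (LEAST k. Q k) else \<infinity>)"
  have len_seq: "key_sequence \<phi> n c j k" if "enat k \<le> len" for k
  proof (rule seq, rule ballI)
    fix i assume i: "i \<in> {1..<k}"
    show "W (\<phi> i) \<noteq> Infty"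
    proof
      assume "W (\<phi> i) = Infty"
      then have "Q i" using i by (simp add: Q_def)
      then have "len \<le> enat i" by (auto simp: len_def intro: Least_le)
      with that i show False by (metis atLeastLessThan_iff enat_ord_simps(1) leD order_trans)
    qed
  qed
  have "1 \<le> len"
  proof (cases "\<exists>k. Q k")
    case True
    then have "Q (LEAST k. Q k)" by (rule LeastI_ex)
    then have "1 \<le> (LEAST k. Q k)" using Q_def by blast
    then show ?thesis using True by (simp add: len_def one_enat_def)
  qed (simp add: len_def)
  then have "approximant_sequence V0 f len \<phi> (\<lambda>i. W (\<phi> i)) (stage \<phi>)"
    unfolding approximant_sequence_def using approximant_stage len_seq by blast
  moreover have "\<phi> 1 = [:0, 1:]"
    using len_seq[of 1] \<open>1 \<le> len\<close> by (simp add: one_enat_def key_sequence_def)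
  moreover have "\<phi> i = \<phi> (i - 1) ^ n (i - 1) - smult (c (i - 1)) (\<Prod>l = 1..i - 2. \<phi> l ^ j l (i - 1)) \<and>
        c (i - 1) \<in> valuation_ring V0 \<and>
        has_index (stage_group V0 (stage \<phi>) (i - 1)) (stage_group V0 (stage \<phi>) (i - 2)) (n (i - 1)) \<and>
        (\<forall>l\<in>{1..i - 2}. j l (i - 1) < n l)" if i: "2 \<le> i" "enat i \<le> len" for i
  proof -
    \<comment> \<open>Step \<open>m\<close> leads to \<open>\<phi> i\<close>; for
      \<open>i \<ge> 2\<close> the range \<open>{1..i - 2}\<close> equals
      \<open>{1..<m}\<close>.\<close>
    define m where "m = i - 1"
    have m: "1 \<le> m" "m < i" "i = Suc m" "i - 2 = m - 1" using i by (auto simp: m_def)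
    note seq = len_seq[OF i(2)]
    have range: "{1..m - 1} = {1..<m}" using m(1) by auto
    have "next_key \<phi> n m (\<phi> (Suc m)) (n m) (c m) (\<lambda>l. j l m)"
      using seq m by (simp add: key_sequence_def)
    then show ?thesis
      using has_index_stage_group[OF seq m(1,2)]
      unfolding m_def[symmetric] m(4) range next_key_def key_monomial_def valuation_ring_def
      by (simp add: m(3))
  qed
  moreover have "(\<exists>k. len = enat k \<and> \<phi> k = f \<and> stage \<phi> k f = Infty) \<or> len = \<infinity>"
  proof (cases "\<exists>k. Q k")
    case True
    define k where "k = (LEAST k. Q k)"
    have "Q k" unfolding k_def using True by (rule LeastI_ex)
    have "len = enat k" using True by (simp add: len_def k_def)
    moreover have "\<phi> k = f"
      using last_key_eq_f len_seq[of k] \<open>Q k\<close> \<open>len = enat k\<close> by (simp add: Q_def)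
    ultimately show ?thesis using augment_self_Infty W_f by auto
  qed (simp add: len_def)
  ultimately show ?thesis by blast
qed

end

theorem theorem4p1:
  fixes V0 :: "'a::field \<Rightarrow> 'g::linordered_ab_group_add vext"
    and W :: "'a poly \<Rightarrow> 'g vext"
    and f :: "'a poly"
  assumes "valuation V0"
    and "\<exists>k. subfield k (ring_of_type_algebra :: 'a ring) \<and>
             k \<subseteq> valuation_ring V0 \<and>
             algebraically_closed (ring_of_type_algebra \<lparr>carrier := k\<rparr>) \<and>
             (ring_of_type_algebra \<lparr>carrier := valuation_ring V0\<rparr>) Quot (valuation_ideal V0)
               \<simeq> ring_of_type_algebra \<lparr>carrier := k\<rparr>"
    and "\<forall>i. coeff f i \<in> valuation_ring V0"
    and "irreducible f"
    and "lead_coeff f = 1"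
    and "pseudo_valuation W"
    and "\<forall>a. W [:a:] = V0 a"
    and "infinity_ideal W = {g. f dvd g}"
  shows "\<exists>(len :: enat) (\<phi> :: nat \<Rightarrow> 'a poly) (V :: nat \<Rightarrow> 'a poly \<Rightarrow> 'g vext)
            (c :: nat \<Rightarrow> 'a) (n :: nat \<Rightarrow> nat) (j :: nat \<Rightarrow> nat \<Rightarrow> nat).
          approximant_sequence V0 f len \<phi> (\<lambda>i. W (\<phi> i)) V \<and>
          \<phi> 1 = [:0, 1:] \<and>
          (\<forall>i\<ge>2. enat i \<le> len \<longrightarrow>
             \<phi> i = \<phi> (i - 1) ^ n (i - 1)
                    - smult (c (i - 1)) (\<Prod>l = 1..i - 2. \<phi> l ^ j l (i - 1)) \<and>
             c (i - 1) \<in> valuation_ring V0 \<and>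
             has_index (stage_group V0 V (i - 1)) (stage_group V0 V (i - 2)) (n (i - 1)) \<and>
             (\<forall>l\<in>{1..i - 2}. j l (i - 1) < n l)) \<and>
          ((\<exists>k. len = enat k \<and> \<phi> k = f \<and> V k f = Infty) \<or> len = \<infinity>)"
proof -
  obtain F :: "'a set" where F: "algebraically_closed (ring_of_type_algebra \<lparr>carrier := F\<rparr>)"
    "(ring_of_type_algebra \<lparr>carrier := valuation_ring V0\<rparr>) Quot (valuation_ideal V0)
       \<simeq> ring_of_type_algebra \<lparr>carrier := F\<rparr>"
    using assms(2) by blast
  interpret V0: pseudo_val V0 by (rule valuation_pseudo_val[OF assms(1)])
  interpret W: pseudo_val W
    using assms(6) unfolding pseudo_valuation_iff by unfold_locales blast+
  interpret approximation V0 F W f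
  proof (intro approximation.intro residue_extension.intro residue_valuation.intro
      residue_valuation_axioms.intro residue_extension_axioms.intro approximation_axioms.intro)
    show "V0 a = Infty \<Longrightarrow> a = 0" for a using assms(1) by (simp add: valuation_def)
    show "W g = Infty \<longleftrightarrow> f dvd g" for g using assms(8) by (auto simp: infinity_ideal_def)
    show "0 \<le> V0 (coeff f i)" for i using assms(3) by (simp add: valuation_ring_def)
  qed (use F assms(4,5,7) V0.pseudo_val_axioms W.pseudo_val_axioms in blast)+
  show ?thesis by (rule approximant_sequence_exists)
qed

end
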